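(* Assume each $f_i:\mathbb R^d\to\mathbb R$ ($i=1,\dots,m$) is $\mu_i$-strongly convex with $\mu_i>0$ and twice differentiable, with $L_{1,i}$-Lipschitz gradient and $L_{2,i}$-Lipschitz Hessian (operator norm); put $\bar\mu=\frac1m\sum_i\mu_i$, $\hat\mu=\min_i\mu_i$. Consider the Accelerated Decentralized Cubic Newton algorithm (see context), started from a common point $x_i^0=x^0$ for all $i$, let $R=\|x^0-x^*\|$, and assume there is $\bar R>0$ such that for all $k\ge1$ $$\max_{i}\{\|x_i^k-x^*\|,\|y_i^k-x^*\|,\|\hat v_i^k-x^*\|,\|v_i^k-x^*\|\}\le\bar R .$$ Let $\varepsilon>0$ and $$\alpha_k=\alpha=\min\Big\{\tfrac45,\Big(\tfrac{3\bar\mu\bar R^{-1}}{160\bar L_2}\Big)^{1/3}\Big\}.$$ Suppose the consensus error levels satisfy, for every $k=0,\dots,N$, $$\hat\Delta_{H|\hat v,k}=\hat\Delta_{H|\hat v}\le\min\Big\{\tfrac{\bar\mu}{60\sqrt5\,\alpha^2},\tfrac{\alpha\hat\mu\varepsilon}{320\bar L_1\bar R^2}\Big\},\qquad \hat\Delta_{g|\hat v,k}=\hat\Delta_{g|\hat v}\le\min\Big\{\tfrac{\alpha\hat\mu\varepsilon}{160\bar L_1\bar R},\tfrac{\alpha\varepsilon}{160\bar R}\Big\},$$ $$\hat\Delta_{\hat v,k}=\hat\Delta_{\hat v}\le\min\Big\{\tfrac{\bar\mu}{120\sqrt5\,\alpha^2\bar L_2},\tfrac{\alpha\varepsilon}{320\bar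 L_1\bar R}\Big\},\qquad \hat\Delta_{g|x,k+1}=\hat\Delta_{g|x}\le\tfrac{\varepsilon}{8\bar R},$$ and that the algorithm is run with $L=3\bar L_2$, $\delta_{2,k}=3\Delta_{2|\hat v,k}$, $\bar\kappa_{2,k}=\frac{\bar\mu}2$, $\bar\kappa_{3,k}=\frac32\bar\mu\bar R^{-1}$ for all $k=0,\dots,N$. If $$N\ge\Big\lceil\frac{\log\big(2C(f(\bar x^0)-f(x^* ))/\varepsilon\big)}{\log(1/(1-\alpha))}\Big\rceil,\qquad C=\tfrac{4\Delta_{1|\hat v,0}}{\bar\mu R}+\tfrac{4\Delta_{1|\hat v,0}\bar R}{\bar\mu R^2}+\tfrac{4\Delta_{2|\hat v,0}}{\bar\mu}+\tfrac12+\tfrac{8\bar L_2+3\bar\mu\bar R^{-1}}{6\bar\mu}R,$$ then after $N+1$ iterations $f(\bar x^{N+1})-f(x^* )\le\varepsilon$.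
   Context: Setting: $m$ nodes, $f=\frac1m\sum_{i=1}^m f_i$ on $\mathbb R^d$, $x^*$ the minimizer of $f$. $\bar L_p=\frac1m\sum_{i=1}^m L_{p,i}$, $p=1,2$. Constants appearing in denominators are assumed positive. $\|\cdot\|$ is the Euclidean norm, $\|\cdot\|_{\rm op}$ the operator norm. Consensus: there are mixing matrices $W^1,W^2,\dots\in\mathbb R^{m\times m}$ with nonnegative entries, $W^k\mathbf 1=\mathbf 1$, $\mathbf 1^\top W^k=\mathbf 1^\top$. Consensus applied to $\{u_j\}_{j=1}^m$ with $T$ rounds stacks the $u_j^\top$ as rows of a matrix $U$ and multiplies it by a product of $T$ consecutive mixing matrices; node $i$ receives the $i$-th row. Hessians are flattened into vectors of $\mathbb R^{d^2}$. Accelerated Decentralized Cubic Newton: parameters $N\ge1$, $L>0$, $\delta_{2,k}\ge0$, $\bar\kappa_{2,k},\bar\kappa_{3,k}$, $\alpha_k\in(0,1)$, $A_0=1$, $A_k=\prod_{j=1}^k(1-\alpha_j)$, numbers of consensus rounds. Local cubic model: $$\hat\nu_i^k(x;\hat v_i^k)=\langle\hat g_i(\hat v_i^k),x-\hat v_i^k\rangle+\tfrac12\langle\hat H_i(\hat v_i^k)(x-\hat v_i^k),x-\hat v_i^k\rangle+\tfrac{\delta_{2,k}}2\|x-\hat v_i^k\|^2+\tfrac L6\|x-\hat v_i^k\|^3.$$ At $k=0$ set $v_i^0=x_i^0$. For $k=1,\dots,N$ set $v_i^k=(1-\alpha_k)x_i^k+\alpha_ky_i^k$. For each $k=0,\dots,N$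 node $i$: obtains $\hat v_i^k$ by Consensus on $\{v_j^k\}_j$; obtains $\hat g_i(\hat v_i^k),\hat H_i(\hat v_i^k)$ by Consensus on $\{\nabla f_j(\hat v_j^k)\}_j,\{\nabla^2f_j(\hat v_j^k)\}_j$; sets $x_i^{k+1}=\arg\min_x\hat\nu_i^k(x;\hat v_i^k)$; obtains $\hat g_i(x_i^{k+1})$ by Consensus on $\{\nabla f_j(x_j^{k+1})\}_j$; sets $y_i^{k+1}=\arg\min_x\psi_i^{k+1}(x)$, where $$\psi_i^1(x)=f(x_i^1)+\tfrac{\bar\kappa_{2,0}}2\|x-\hat v_i^0\|^2+\tfrac{\bar\kappa_{3,0}}6\|x-\hat v_i^0\|^3,$$ and for $k\ge1$ $$\psi_i^{k+1}(x)=\psi_i^k(x)+\tfrac{\bar\kappa_{2,k}-\bar\kappa_{2,k-1}}2\|x-\hat v_i^0\|^2+\tfrac{\bar\kappa_{3,k}-\bar\kappa_{3,k-1}}6\|x-\hat v_i^0\|^3+\tfrac{\alpha_k}{A_k}\Big(f(x_i^{k+1})+\langle\hat g_i(x_i^{k+1}),x-x_i^{k+1}\rangle+\tfrac{\bar\mu}2\|x-x_i^{k+1}\|^2\Big).$$ $\bar x^k=\frac1m\sum_ix_i^k$, $\bar v^k=\frac1m\sum_iv_i^k$. Consensus error levels are numbers such that $\max_i\|\hat v_i^k-\bar v^k\|\le\hat\Delta_{\hat v,k}$, $\max_i\|\hat g_i(\hat v_i^k)-\frac1m\sum_j\nabla f_j(\hat v_j^k)\|\le\hat\Delta_{g|\hat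 v,k}$, $\max_i\|\hat H_i(\hat v_i^k)-\frac1m\sum_j\nabla^2f_j(\hat v_j^k)\|_{\rm op}\le\hat\Delta_{H|\hat v,k}$, $\max_i\|\hat g_i(x_i^{k})-\frac1m\sum_j\nabla f_j(x_j^{k})\|\le\hat\Delta_{g|x,k}$. Aggregated errors: $\Delta_{1|\hat v,k}=\hat\Delta_{g|\hat v,k}+2\bar L_1\hat\Delta_{\hat v,k}$, $\Delta_{2|\hat v,k}=\hat\Delta_{H|\hat v,k}+2\bar L_2\hat\Delta_{\hat v,k}$. *)

theory Defs
  imports "HOL-Analysis.Analysis"
begin

definition gradient :: "(real^'d \<Rightarrow> real) \<Rightarrow> real^'d \<Rightarrow> real^'d" where
  "gradient f z = (THE D. GDERIV f z :> D)"

definition hessian :: "(real^'d \<Rightarrow> real) \<Rightarrow> real^'d \<Rightarrow> real^'d^'d" where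
  "hessian f z = jacobian (gradient f) (at z)"

definition twice_differentiable :: "(real^'d \<Rightarrow> real) \<Rightarrow> bool" where
  "twice_differentiable f \<longleftrightarrow>
     (\<forall>z. f differentiable (at z)) \<and> (\<forall>z. gradient f differentiable (at z))"

definition op_norm :: "real^'d^'d \<Rightarrow> real" where
  "op_norm M = onorm (\<lambda>h. M *v h)"

definition strongly_convex :: "real \<Rightarrow> (real^'d \<Rightarrow> real) \<Rightarrow> bool" where
  "strongly_convex \<mu> f \<longleftrightarrow>
     (\<forall>y z. \<forall>t\<in>{0..1}.
        f ((1 - t) *\<^sub>R y + t *\<^sub>R z)
          \<le> (1 - t) * f y + t * f z - \<mu> / 2 * t * (1 - t) * (norm (y - z))\<^sup>2)"

definition node_mean :: "('m::finite \<Rightarrow> 'a::real_vector) \<Rightarrow> 'a" where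
  "node_mean u = (1 / real CARD('m)) *\<^sub>R (\<Sum>i\<in>UNIV. u i)"

definition mixing_matrix :: "real^'m^'m \<Rightarrow> bool" where
  "mixing_matrix W \<longleftrightarrow>
     (\<forall>i j. 0 \<le> W $ i $ j) \<and> W *v vec 1 = vec 1 \<and> vec 1 v* W = vec 1"

(* The product W (s + T) ** ... ** W (s + 1): the T rounds that follow the first s. *)
primrec mixing_product :: "(nat \<Rightarrow> real^'m^'m) \<Rightarrow> nat \<Rightarrow> nat \<Rightarrow> real^'m^'m" where
  "mixing_product W s 0 = mat 1"
| "mixing_product W s (Suc T) = W (s + Suc T) ** mixing_product W s T"

definition consensus ::
  "(nat \<Rightarrow> real^'m^'m) \<Rightarrow> nat \<Rightarrow> nat \<Rightarrow> ('m \<Rightarrow> real^'n) \<Rightarrow> 'm \<Rightarrow> real^'n" where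
  "consensus W s T u i = (mixing_product W s T ** (\<chi> j. u j)) $ i"

definition flatten_matrix :: "real^'d^'d \<Rightarrow> real^('d \<times> 'd)" where
  "flatten_matrix M = (\<chi> p. M $ fst p $ snd p)"

definition unflatten_matrix :: "real^('d \<times> 'd) \<Rightarrow> real^'d^'d" where
  "unflatten_matrix w = (\<chi> a b. w $ (a, b))"

definition consensus_matrix ::
  "(nat \<Rightarrow> real^'m^'m) \<Rightarrow> nat \<Rightarrow> nat \<Rightarrow> ('m \<Rightarrow> real^'d^'d) \<Rightarrow> 'm \<Rightarrow> real^'d^'d" where
  "consensus_matrix W s T M i =
     unflatten_matrix (consensus W s T (\<lambda>j. flatten_matrix (M j)) i)"

definition cubic_model ::
  "real \<Rightarrow> real \<Rightarrow> real^'d \<Rightarrow> real^'d \<Rightarrow> real^'d^'d \<Rightarrow> real^'d \<Rightarrow> real" where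
  "cubic_model L \<delta> v g H z =
     g \<bullet> (z - v) + 1/2 * ((H *v (z - v)) \<bullet> (z - v))
       + \<delta> / 2 * (norm (z - v))\<^sup>2 + L / 6 * (norm (z - v)) ^ 3"

definition A_seq :: "(nat \<Rightarrow> real) \<Rightarrow> nat \<Rightarrow> real" where
  "A_seq \<alpha> k = (\<Prod>j=1..k. 1 - \<alpha> j)"

(* The functions psi^1, psi^2, ... of a single node, which enters through its anchor vh0 and its
   sequences x, g of iterates and mixed gradients. Index 0 is never used; its value is a dummy. *)
primrec est_fun ::
  "(real^'d \<Rightarrow> real) \<Rightarrow> (nat \<Rightarrow> real) \<Rightarrow> (nat \<Rightarrow> real) \<Rightarrow> (nat \<Rightarrow> real) \<Rightarrow> real \<Rightarrow>
   real^'d \<Rightarrow> (nat \<Rightarrow> real^'d) \<Rightarrow> (nat \<Rightarrow> real^'d) \<Rightarrow> nat \<Rightarrow> real^'d \<Rightarrow> real" where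
  "est_fun f \<kappa>2 \<kappa>3 \<alpha> \<mu> vh0 x g 0 z = 0"
| "est_fun f \<kappa>2 \<kappa>3 \<alpha> \<mu> vh0 x g (Suc k) z =
     (if k = 0 then
        f (x 1) + \<kappa>2 0 / 2 * (norm (z - vh0))\<^sup>2 + \<kappa>3 0 / 6 * (norm (z - vh0)) ^ 3
      else
        est_fun f \<kappa>2 \<kappa>3 \<alpha> \<mu> vh0 x g k z
          + (\<kappa>2 k - \<kappa>2 (k - 1)) / 2 * (norm (z - vh0))\<^sup>2
          + (\<kappa>3 k - \<kappa>3 (k - 1)) / 6 * (norm (z - vh0)) ^ 3
          + \<alpha> k / A_seq \<alpha> k *
              (f (x (k + 1)) + g (k + 1) \<bullet> (z - x (k + 1))
                 + \<mu> / 2 * (norm (z - x (k + 1)))\<^sup>2))"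

end

theory Submission
  imports Defs
begin

text \<open>Every node runs an accelerated cubic Newton method on the common objective \<open>f\<close>, but with a gradient,
a Hessian and a gradient in its estimating function that are only approximately those of \<open>f\<close>. The
consensus error levels turn into errors \<open>d1\<close> and \<open>d2\<close> of the local gradients and Hessians at the
points \<open>vh k i\<close>, because the node gradients and Hessians are Lipschitz and their arguments are
\<open>2 * Dv\<close>-close to each other.

One step has two ingredients. For the cubic step \<open>h\<close>, the parameters \<open>L = 3 * L2bar\<close> and
\<open>\<delta>2 = 3 * D2\<close> make the gradient at the new point equal to \<open>- \<zeta> *\<^sub>R h\<close> up to a third of its
length and an error \<open>d1\<close> (\<open>inexact_cubic_step_residual\<close>). Hence moving along \<open>h\<close> gains enough to
pay for the movement of the minimizer of the estimating function, which is controlled by the strong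
convexity of that function (\<open>cubic_step_progress\<close>). Where the Hessian error dominates the step,
quadratic growth pays if \<open>\<alpha>\<^sup>2 * d2\<close> is small. Elsewhere cubic growth is required; quadratic growth
implies it, because the iterates stay in a ball of radius \<open>Rbar\<close>, and it pays if
\<open>L2bar * Rbar * \<alpha> ^ 3\<close> is small compared to \<open>\<mu>bar\<close>. For the estimating function, the gap
\<open>\<psi>(xstar) - \<psi>(y)\<close> between the optimum and the minimizer of \<open>\<psi>\<close> is followed instead of the two
values separately; the gradient error then only meets the vector \<open>xstar - y\<close>, of length at most
\<open>Rbar\<close>, and the error budget closes with room to spare. Together they give
\<open>accelerated_step_potential\<close>: the gap plus \<open>(f x - f xstar) / A_k\<close> grows by a controlled error only.

Two points are decentralized in nature. First, the gradient that node \<open>i\<close> receives at its new point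
is an average of node gradients at the different points \<open>x (k + 1) j\<close>. These are close to each other
because the optimality condition of the cubic model is strongly monotone with modulus \<open>\<mu>hat\<close>: a mixed
Hessian is a convex combination of node Hessians (\<open>cubic_stationary_perturbation\<close>). Second, \<open>v k i\<close>
is close to \<open>vh k i\<close> only in the mean over the nodes, so the potential has to be averaged over the
nodes; up to the small disagreement, the difference is then paired with one common gradient.

Telescoping the averaged potential bounds the mean of \<open>f (x (N + 1) i) - f xstar\<close> by \<open>\<epsilon> / 2\<close> plus
\<open>(1 - \<alpha>) ^ N\<close> times the initial potential. The latter is at most \<open>C * (f x0 - f xstar)\<close> by one
inexact cubic step from \<open>x0\<close> and strong convexity, and the choice of \<open>N\<close> makes the product at most
\<open>\<epsilon> / 2\<close>. Jensen's inequality passes to the averaged point.\<close>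

section \<open>Averages over the nodes\<close>

lemma linear_node_mean:
  assumes "linear F"
  shows "F (node_mean u) = node_mean (\<lambda>i. F (u i))"
  by (simp add: node_mean_def linear_scale[OF assms] linear_sum[OF assms])

lemma node_mean_const [simp]: "node_mean (\<lambda>_::'m::finite. c) = c"
proof -
  have "(\<Sum>i\<in>(UNIV::'m set). c) = real CARD('m) *\<^sub>R c"
    by (simp add: sum_constant_scaleR)
  then show ?thesis by (simp add: node_mean_def)
qed

lemma node_mean_add: "node_mean (\<lambda>i. u i + w i) = node_mean u + node_mean w"
  by (simp add: node_mean_def sum.distrib scaleR_add_right)

lemma node_mean_diff: "node_mean (\<lambda>i. u i - w i) = node_mean u - node_mean w"
  by (simp add: node_mean_def sum_subtractf scaleR_diff_right)

lemma node_mean_cmult: "node_mean (\<lambda>i. c * u i) = c * node_mean u" for c :: real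
  by (rule linear_node_mean[where F = "(\<lambda>z. c * z)", symmetric])
    (simp add: linear_iff algebra_simps)

lemma node_mean_mult_right: "node_mean (\<lambda>i. u i * c) = node_mean u * c" for c :: real
  by (rule linear_node_mean[where F = "(\<lambda>z. z * c)", symmetric])
    (simp add: linear_iff algebra_simps)

lemma node_mean_inner: "node_mean (\<lambda>i. u i \<bullet> w) = node_mean u \<bullet> w"
  by (rule linear_node_mean[where F = "(\<lambda>z. z \<bullet> w)", symmetric])
    (simp add: linear_iff algebra_simps)

lemma node_mean_matrix_vector:
  fixes M :: "'m::finite \<Rightarrow> real^'b^'a"
  shows "node_mean (\<lambda>i. M i *v h) = node_mean M *v h"
  by (rule linear_node_mean[where F = "\<lambda>B. B *v h", symmetric])
    (simp add: linear_iff matrix_vector_mult_add_rdistrib scaleR_matrix_vector_assoc)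

lemma node_mean_mono:
  fixes u w :: "'m::finite \<Rightarrow> real"
  assumes "\<And>i. u i \<le> w i"
  shows "node_mean u \<le> node_mean w"
  using assms by (auto simp: node_mean_def intro!: divide_right_mono sum_mono)

lemma node_mean_le_const:
  fixes u :: "'m::finite \<Rightarrow> real"
  assumes "\<And>i. u i \<le> c"
  shows "node_mean u \<le> c"
  using node_mean_mono[of u "\<lambda>_. c"] assms by simp

lemma norm_node_mean_le: "norm (node_mean u) \<le> node_mean (\<lambda>i. norm (u i))"
  by (auto simp: node_mean_def norm_sum intro!: divide_right_mono)

lemma norm_node_mean_le_const:
  assumes "\<And>i. norm (u i) \<le> c"
  shows "norm (node_mean u) \<le> c"
  by (rule order_trans[OF norm_node_mean_le node_mean_le_const]) (rule assms)

lemma node_mean_pos: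
  fixes u :: "'m::finite \<Rightarrow> real"
  assumes "\<And>i. u i > 0"
  shows "node_mean u > 0"
  using assms by (simp add: node_mean_def sum_pos)

lemma has_derivative_node_mean:
  assumes "\<And>i. (F i has_derivative F' i) net"
  shows "((\<lambda>z. node_mean (\<lambda>i. F i z)) has_derivative (\<lambda>h. node_mean (\<lambda>i. F' i h))) net"
  unfolding node_mean_def by (intro derivative_intros assms)

section \<open>Consensus rounds take convex combinations\<close>

lemma mixing_product_stochastic:
  fixes W :: "nat \<Rightarrow> real^'m^'m"
  assumes "\<And>k. k \<ge> 1 \<Longrightarrow> mixing_matrix (W k)"
  shows "0 \<le> mixing_product W s T $ i $ j"
    and "(\<Sum>j\<in>UNIV. mixing_product W s T $ i $ j) = 1"
proof -
  have rows: "mixing_product W s T *v vec 1 = vec 1"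
  proof (induction T)
    case (Suc T)
    have "W (s + Suc T) *v vec 1 = vec 1"
      using assms[of "s + Suc T"] by (simp add: mixing_matrix_def)
    with Suc show ?case by (simp flip: matrix_vector_mul_assoc)
  qed simp
  from arg_cong[OF this, of "\<lambda>w. w $ i"]
  show "(\<Sum>j\<in>UNIV. mixing_product W s T $ i $ j) = 1"
    by (simp add: matrix_vector_mult_def)
  show "0 \<le> mixing_product W s T $ i $ j"
  proof (induction T arbitrary: i j)
    case 0
    then show ?case by (simp add: mat_def)
  next
    case (Suc T)
    have "0 \<le> W (s + Suc T) $ a $ b" for a b
      using assms[of "s + Suc T"] by (simp add: mixing_matrix_def)
    with Suc show ?case by (auto simp: matrix_matrix_mult_def intro!: sum_nonneg)
  qed
qed

lemma consensus_eq_sum: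
  "consensus W s T u i = (\<Sum>j\<in>UNIV. mixing_product W s T $ i $ j *\<^sub>R u j)"
  by (simp add: consensus_def matrix_matrix_mult_def vec_eq_iff)

lemma consensus_matrix_eq_sum:
  "consensus_matrix W s T M i = (\<Sum>j\<in>UNIV. mixing_product W s T $ i $ j *\<^sub>R M j)"
  by (simp add: consensus_matrix_def consensus_eq_sum unflatten_matrix_def flatten_matrix_def
      vec_eq_iff)

lemma consensus_const:
  fixes W :: "nat \<Rightarrow> real^'m^'m"
  assumes "\<And>k. k \<ge> 1 \<Longrightarrow> mixing_matrix (W k)"
  shows "consensus W s T (\<lambda>_. c) i = c"
  using mixing_product_stochastic(2)[where W = W and s = s and T = T and i = i, OF assms]
  by (simp add: consensus_eq_sum flip: scaleR_sum_left)

lemma consensus_matrix_mult: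
  "consensus_matrix W s T M i *v a = (\<Sum>j\<in>UNIV. mixing_product W s T $ i $ j *\<^sub>R (M j *v a))"
proof -
  have "linear (\<lambda>B. B *v a)"
    by (simp add: linear_iff matrix_vector_mult_add_rdistrib scaleR_matrix_vector_assoc)
  from linear_sum[OF this] show ?thesis
    by (simp add: consensus_matrix_eq_sum scaleR_matrix_vector_assoc)
qed

lemma consensus_matrix_symmetric:
  assumes "\<And>j a b. (M j *v a) \<bullet> b = a \<bullet> (M j *v b)"
  shows "(consensus_matrix W s T M i *v a) \<bullet> b = a \<bullet> (consensus_matrix W s T M i *v b)"
  by (simp add: consensus_matrix_mult inner_sum_left inner_sum_right assms)

lemma consensus_matrix_ge:
  fixes W :: "nat \<Rightarrow> real^'m^'m"
  assumes mixing: "\<And>k. k \<ge> 1 \<Longrightarrow> mixing_matrix (W k)"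
    and ge: "\<And>j. c * (norm a)\<^sup>2 \<le> (M j *v a) \<bullet> a"
  shows "c * (norm a)\<^sup>2 \<le> (consensus_matrix W s T M i *v a) \<bullet> a"
proof -
  let ?P = "mixing_product W s T"
  have "c * (norm a)\<^sup>2 = (\<Sum>j\<in>UNIV. ?P $ i $ j * (c * (norm a)\<^sup>2))"
    using mixing_product_stochastic(2)[where W = W and s = s and T = T and i = i, OF mixing]
    by (simp flip: sum_distrib_right)
  also have "\<dots> \<le> (\<Sum>j\<in>UNIV. ?P $ i $ j * ((M j *v a) \<bullet> a))"
    by (intro sum_mono mult_left_mono ge mixing_product_stochastic(1) mixing)
  finally show ?thesis by (simp add: consensus_matrix_mult inner_sum_left)
qed

lemma norm_matrix_vector_le_op_norm: "norm (M *v h) \<le> op_norm M * norm h"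
  unfolding op_norm_def by (rule onorm) (rule matrix_vector_mul_bounded_linear)

section \<open>Functions with Lipschitz Hessian\<close>

text \<open>Letting \<open>t\<close> tend to \<open>0\<close> removes a linear error term. This replaces the second-order limits in the
proofs about Hessians and minimizers below.\<close>

lemma le_if_le_add_small:
  fixes a b c :: real
  assumes "\<And>t. 0 < t \<Longrightarrow> t < 1 \<Longrightarrow> a \<le> b + t * c"
  shows "a \<le> b"
proof -
  have "((\<lambda>t. b + t * c) \<longlongrightarrow> b + 0 * c) (at_right 0)"
    by (intro tendsto_intros)
  moreover have "\<forall>\<^sub>F t in at_right (0::real). a \<le> b + t * c"
    unfolding eventually_at_right_field using assms by (intro exI[of _ 1]) auto
  ultimately show ?thesis
    using tendsto_lowerbound[of "\<lambda>t. b + t * c" "b + 0 * c" "at_right 0" a] by simp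
qed

text \<open>The gradient and the Hessian are parameters, so that the node objectives and their average, whose
derivatives are the averages of the derivatives, are both instances. The Lipschitz condition is
stated on vectors since this form survives averaging by the triangle inequality.\<close>

locale lipschitz_hessian =
  fixes f :: "real^'d \<Rightarrow> real" and G :: "real^'d \<Rightarrow> real^'d" and H :: "real^'d \<Rightarrow> real^'d^'d"
    and M :: real
  assumes grad: "(f has_derivative (\<lambda>h. G z \<bullet> h)) (at z)"
    and hess: "(G has_derivative (\<lambda>h. H z *v h)) (at z)"
    and hess_lip: "norm ((H z - H w) *v h) \<le> M * norm (z - w) * norm h"
begin

lemma grad_ray: "((\<lambda>t. f (z + t *\<^sub>R h)) has_real_derivative G (z + t *\<^sub>R h) \<bullet> h) (at t)"
proof -
  have "((\<lambda>t. z + t *\<^sub>R h) has_derivative (\<lambda>s. s *\<^sub>R h)) (at t)"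
    by (auto intro!: derivative_eq_intros)
  from has_derivative_compose[OF this grad]
  show ?thesis by (simp add: has_field_derivative_def mult_commute_abs)
qed

lemma hess_ray:
  "((\<lambda>t. G (z + t *\<^sub>R h) \<bullet> e) has_real_derivative (H (z + t *\<^sub>R h) *v h) \<bullet> e) (at t)"
proof -
  have "((\<lambda>t. z + t *\<^sub>R h) has_derivative (\<lambda>s. s *\<^sub>R h)) (at t)"
    by (auto intro!: derivative_eq_intros)
  from has_derivative_compose[OF this hess]
  have "((\<lambda>t. G (z + t *\<^sub>R h) \<bullet> e) has_derivative (\<lambda>s. (H (z + t *\<^sub>R h) *v (s *\<^sub>R h)) \<bullet> e)) (at t)"
    by (rule has_derivative_inner_left)
  then show ?thesis
    by (simp add: has_field_derivative_def mult_commute_abs matrix_vector_mult_scaleR)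
qed

lemma lipschitz_const_nonneg: "0 \<le> M"
  using order_trans[OF norm_ge_zero hess_lip[of "vec 1" 0 "vec 1"]]
  by (auto simp: zero_le_mult_iff vec_eq_iff)

text \<open>The remainder is tested against itself: along the segment, its inner product with a fixed vector has
a derivative that the Lipschitz condition bounds linearly in \<open>t\<close>, so monotonicity of a scalar function
suffices and no integral is needed.\<close>

lemma taylor_grad: "norm (G (z + h) - G z - H z *v h) \<le> M / 2 * (norm h)\<^sup>2"
proof -
  define e where "e = G (z + h) - G z - H z *v h"
  define \<phi> where "\<phi> t = M / 2 * (norm h)\<^sup>2 * norm e * t\<^sup>2
      - (G (z + t *\<^sub>R h) \<bullet> e - t * ((H z *v h) \<bullet> e))" for t
  have deriv: "(\<phi> has_real_derivative M * (norm h)\<^sup>2 * norm e * t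
      - ((H (z + t *\<^sub>R h) - H z) *v h) \<bullet> e) (at t)" for t
    unfolding \<phi>_def
    by (auto intro!: derivative_eq_intros hess_ray simp: algebra_simps)
  have nonneg: "0 \<le> M * (norm h)\<^sup>2 * norm e * t - ((H (z + t *\<^sub>R h) - H z) *v h) \<bullet> e"
    if "0 \<le> t" for t
  proof -
    have "((H (z + t *\<^sub>R h) - H z) *v h) \<bullet> e \<le> norm ((H (z + t *\<^sub>R h) - H z) *v h) * norm e"
      by (rule norm_cauchy_schwarz)
    also have "\<dots> \<le> (M * norm (z + t *\<^sub>R h - z) * norm h) * norm e"
      by (intro mult_right_mono hess_lip) simp
    finally show ?thesis using that by (simp add: power2_eq_square mult_ac)
  qed
  have "\<phi> 0 \<le> \<phi> 1"
  proof (rule DERIV_nonneg_imp_nondecreasing[where f = \<phi> and a = 0 and b = 1])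
    fix t :: real assume "0 \<le> t"
    from deriv[of t] nonneg[OF this]
    show "\<exists>y. (\<phi> has_real_derivative y) (at t) \<and> 0 \<le> y" by (intro exI conjI)
  qed simp
  then have "(norm e)\<^sup>2 \<le> M / 2 * (norm h)\<^sup>2 * norm e"
    by (simp add: \<phi>_def e_def power2_norm_eq_inner inner_diff_left)
  then have "norm e * norm e \<le> (M / 2 * (norm h)\<^sup>2) * norm e"
    by (simp add: power2_eq_square)
  moreover have "0 \<le> M / 2 * (norm h)\<^sup>2" using lipschitz_const_nonneg by simp
  ultimately show ?thesis
    unfolding e_def[symmetric] using mult_right_le_imp_le[of "norm e" "norm e"]
    by (cases "norm e = 0") (auto simp: mult_le_cancel_right)
qed

lemma taylor_fun:
  "\<bar>f (z + h) - f z - G z \<bullet> h - 1/2 * ((H z *v h) \<bullet> h)\<bar> \<le> M / 6 * norm h ^ 3"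
proof -
  define r where "r t = f (z + t *\<^sub>R h) - t * (G z \<bullet> h) - t\<^sup>2 / 2 * ((H z *v h) \<bullet> h)" for t
  define r' where "r' t = (G (z + t *\<^sub>R h) - G z - H z *v (t *\<^sub>R h)) \<bullet> h" for t
  have r: "(r has_real_derivative r' t) (at t)" for t
    unfolding r_def r'_def
    by (auto intro!: derivative_eq_intros grad_ray simp: algebra_simps matrix_vector_mult_scaleR)
  have r': "\<bar>r' t\<bar> \<le> M / 2 * norm h ^ 3 * t\<^sup>2" for t
  proof -
    have "\<bar>r' t\<bar> \<le> norm (G (z + t *\<^sub>R h) - G z - H z *v (t *\<^sub>R h)) * norm h"
      unfolding r'_def by (rule Cauchy_Schwarz_ineq2)
    also have "\<dots> \<le> (M / 2 * (norm (t *\<^sub>R h))\<^sup>2) * norm h"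
      by (intro mult_right_mono taylor_grad) simp
    finally show ?thesis by (simp add: power_mult_distrib power2_eq_square power3_eq_cube mult_ac)
  qed
  have bound: "s * (r 1 - r 0) \<le> M / 6 * norm h ^ 3" if "\<bar>s\<bar> = 1" for s
  proof -
    define \<phi> where "\<phi> t = M / 6 * norm h ^ 3 * t ^ 3 - s * r t" for t
    have deriv: "(\<phi> has_real_derivative M / 2 * norm h ^ 3 * t\<^sup>2 - s * r' t) (at t)" for t
      unfolding \<phi>_def by (auto intro!: derivative_eq_intros r)
    have nonneg: "0 \<le> M / 2 * norm h ^ 3 * t\<^sup>2 - s * r' t" for t
    proof -
      have "s * r' t \<le> \<bar>s * r' t\<bar>" by (rule abs_ge_self)
      also have "\<dots> = \<bar>r' t\<bar>" using that by (simp add: abs_mult)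
      finally have "s * r' t \<le> \<bar>r' t\<bar>" .
      with r'[of t] show ?thesis by linarith
    qed
    have "\<phi> 0 \<le> \<phi> 1"
    proof (rule DERIV_nonneg_imp_nondecreasing[where f = \<phi> and a = 0 and b = 1])
      fix t :: real
      from deriv[of t] nonneg[of t]
      show "\<exists>y. (\<phi> has_real_derivative y) (at t) \<and> 0 \<le> y" by (intro exI conjI)
    qed simp
    then show ?thesis by (simp add: \<phi>_def algebra_simps)
  qed
  have "r 1 - r 0 = f (z + h) - f z - G z \<bullet> h - 1/2 * ((H z *v h) \<bullet> h)"
    by (simp add: r_def)
  moreover have "\<bar>r 1 - r 0\<bar> \<le> M / 6 * norm h ^ 3"
    using bound[of 1] bound[of "-1"] by (intro abs_leI) simp_all
  ultimately show ?thesis by (simp only:)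
qed

text \<open>The mixed second difference of \<open>f\<close> in the directions \<open>t *\<^sub>R a\<close> and \<open>t *\<^sub>R b\<close> is symmetric in \<open>a\<close> and
\<open>b\<close>, and by the mean value theorem it equals \<open>t\<^sup>2 * ((H z *v a) \<bullet> b)\<close> up to an error of order \<open>t ^ 3\<close>.
Symmetry is what makes the first-order condition of a cubic model contain the Hessian itself rather
than its symmetric part.\<close>

lemma hess_symmetric: "(H z *v a) \<bullet> b = a \<bullet> (H z *v b)"
proof -
  define D where "D t a b = f (z + t *\<^sub>R a + t *\<^sub>R b) - f (z + t *\<^sub>R a) - f (z + t *\<^sub>R b) + f z"
    for t a b
  have D_approx: "\<bar>D t a b - t\<^sup>2 * ((H z *v a) \<bullet> b)\<bar>
      \<le> t ^ 3 * (M * (norm a + norm b)\<^sup>2 * norm b)" if t: "0 < t" for t a b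
  proof -
    define \<phi> where "\<phi> s = f (z + t *\<^sub>R a + s *\<^sub>R (t *\<^sub>R b)) - f (z + s *\<^sub>R (t *\<^sub>R b))" for s
    have "(\<phi> has_real_derivative
        (G (z + t *\<^sub>R a + s *\<^sub>R (t *\<^sub>R b)) - G (z + s *\<^sub>R (t *\<^sub>R b))) \<bullet> (t *\<^sub>R b)) (at s)" for s
      unfolding \<phi>_def inner_diff_left by (intro DERIV_diff grad_ray)
    from MVT2[of 0 1 \<phi>, OF _ this] obtain s where s: "0 < s" "s < 1"
      and mvt: "\<phi> 1 - \<phi> 0
        = (G (z + t *\<^sub>R a + s *\<^sub>R (t *\<^sub>R b)) - G (z + s *\<^sub>R (t *\<^sub>R b))) \<bullet> (t *\<^sub>R b)" by auto
    define p q where "p = t *\<^sub>R a + s *\<^sub>R (t *\<^sub>R b)" and "q = s *\<^sub>R (t *\<^sub>R b)"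
    define e where "e = (G (z + p) - G z - H z *v p) - (G (z + q) - G z - H z *v q)"
    have "G (z + p) - G (z + q) = t *\<^sub>R (H z *v a) + e"
      by (simp add: e_def p_def q_def matrix_vector_right_distrib matrix_vector_mult_scaleR)
    then have "D t a b = (t *\<^sub>R (H z *v a) + e) \<bullet> (t *\<^sub>R b)"
      using mvt by (simp add: D_def \<phi>_def p_def q_def add.assoc)
    then have "D t a b - t\<^sup>2 * ((H z *v a) \<bullet> b) = t * (e \<bullet> b)"
      by (simp add: inner_add_left power2_eq_square algebra_simps)
    moreover have "\<bar>e \<bullet> b\<bar> \<le> (M * (t * (norm a + norm b))\<^sup>2) * norm b"
    proof -
      have sb: "norm q \<le> t * norm b" using s t by (simp add: q_def mult_left_le_one_le)
      have "norm p \<le> t * norm a + norm q"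
        using t norm_triangle_ineq[of "t *\<^sub>R a" q] by (simp add: p_def q_def)
      with sb have pn: "norm p \<le> t * (norm a + norm b)" by (simp add: algebra_simps)
      have qn: "norm q \<le> t * (norm a + norm b)"
        using sb t by (simp add: algebra_simps add_increasing)
      have "norm e \<le> M / 2 * (norm p)\<^sup>2 + M / 2 * (norm q)\<^sup>2"
        unfolding e_def by (rule norm_triangle_le_diff) (intro add_mono taylor_grad)
      also have "\<dots> \<le> M / 2 * (t * (norm a + norm b))\<^sup>2 + M / 2 * (t * (norm a + norm b))\<^sup>2"
        using pn qn lipschitz_const_nonneg by (intro add_mono mult_left_mono power_mono) auto
      finally have "norm e \<le> M * (t * (norm a + norm b))\<^sup>2" by simp
      then have "norm e * norm b \<le> M * (t * (norm a + norm b))\<^sup>2 * norm b"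
        by (rule mult_right_mono) simp
      with Cauchy_Schwarz_ineq2[of e b] show ?thesis by linarith
    qed
    then have "\<bar>t * (e \<bullet> b)\<bar> \<le> t * ((M * (t * (norm a + norm b))\<^sup>2) * norm b)"
      using t by (simp add: abs_mult)
    ultimately show ?thesis
      by (simp add: power_mult_distrib power2_eq_square power3_eq_cube mult_ac)
  qed
  have le: "(H z *v a) \<bullet> b \<le> a \<bullet> (H z *v b)" for a b
  proof (rule le_if_le_add_small)
    fix t :: real assume t: "0 < t"
    let ?c = "M * (norm a + norm b)\<^sup>2 * norm b + M * (norm b + norm a)\<^sup>2 * norm a"
    have "D t a b = D t b a" by (simp add: D_def add.commute add.left_commute)
    with D_approx[OF t, of a b] D_approx[OF t, of b a]
    have "t\<^sup>2 * ((H z *v a) \<bullet> b) \<le> t\<^sup>2 * (a \<bullet> (H z *v b)) + t ^ 3 * ?c"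
      by (simp add: inner_commute algebra_simps)
    then have "t\<^sup>2 * ((H z *v a) \<bullet> b) \<le> t\<^sup>2 * (a \<bullet> (H z *v b) + t * ?c)"
      by (simp add: power2_eq_square power3_eq_cube algebra_simps)
    then show "(H z *v a) \<bullet> b \<le> a \<bullet> (H z *v b) + t * ?c" using t by simp
  qed
  from le[of a b] le[of b a] show ?thesis by (simp add: inner_commute)
qed

lemma strongly_convex_gradient:
  assumes "strongly_convex \<mu> f"
  shows "f z + G z \<bullet> (w - z) + \<mu> / 2 * (norm (w - z))\<^sup>2 \<le> f w"
proof -
  let ?h = "w - z"
  have "((\<lambda>t. (f (z + t *\<^sub>R ?h) - f z) / t) \<longlongrightarrow> G z \<bullet> ?h) (at 0)"
    using grad_ray[of z ?h 0] by (simp add: has_field_derivative_iff)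
  then have lim: "((\<lambda>t. (f (z + t *\<^sub>R ?h) - f z) / t) \<longlongrightarrow> G z \<bullet> ?h) (at_right 0)"
    by (rule tendsto_mono[rotated]) (simp add: at_le)
  have "((\<lambda>t. f w - f z - \<mu> / 2 * (1 - t) * (norm ?h)\<^sup>2)
      \<longlongrightarrow> f w - f z - \<mu> / 2 * (1 - 0) * (norm ?h)\<^sup>2) (at_right 0)"
    by (intro tendsto_intros)
  moreover have "\<forall>\<^sub>F t in at_right (0::real).
      (f (z + t *\<^sub>R ?h) - f z) / t \<le> f w - f z - \<mu> / 2 * (1 - t) * (norm ?h)\<^sup>2"
    unfolding eventually_at_right_field
  proof (intro exI[of _ 1] conjI allI impI)
    fix t :: real assume t: "0 < t" "t < 1"
    have "f ((1 - t) *\<^sub>R z + t *\<^sub>R w)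
        \<le> (1 - t) * f z + t * f w - \<mu> / 2 * t * (1 - t) * (norm (z - w))\<^sup>2"
      using assms t by (auto simp: strongly_convex_def)
    moreover have "(1 - t) *\<^sub>R z + t *\<^sub>R w = z + t *\<^sub>R ?h" by (simp add: algebra_simps)
    ultimately have "f (z + t *\<^sub>R ?h) - f z
        \<le> (f w - f z - \<mu> / 2 * (1 - t) * (norm ?h)\<^sup>2) * t"
      by (simp add: algebra_simps norm_minus_commute[of z w])
    then show "(f (z + t *\<^sub>R ?h) - f z) / t \<le> f w - f z - \<mu> / 2 * (1 - t) * (norm ?h)\<^sup>2"
      using t by (simp add: pos_divide_le_eq)
  qed simp
  ultimately have "G z \<bullet> ?h \<le> f w - f z - \<mu> / 2 * (1 - 0) * (norm ?h)\<^sup>2"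
    by (intro tendsto_le[OF _ _ lim]) auto
  then show ?thesis by simp
qed

lemma strongly_convex_monotone:
  assumes "strongly_convex \<mu> f"
  shows "\<mu> * (norm (w - z))\<^sup>2 \<le> (G w - G z) \<bullet> (w - z)"
proof -
  have "G w \<bullet> (z - w) = - (G w \<bullet> (w - z))" by (simp add: inner_diff_right)
  with strongly_convex_gradient[OF assms, of z w] strongly_convex_gradient[OF assms, of w z]
  show ?thesis by (simp add: inner_diff_left norm_minus_commute[of z w])
qed

text \<open>Divide the strong monotonicity of the gradient between \<open>z\<close> and \<open>z + t *\<^sub>R h\<close> by \<open>t\<^sup>2\<close>; the Taylor
remainder contributes a multiple of \<open>t\<close>.\<close>

lemma strongly_convex_hessian:
  assumes "strongly_convex \<mu> f"
  shows "\<mu> * (norm h)\<^sup>2 \<le> (H z *v h) \<bullet> h"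
proof (rule le_if_le_add_small)
  fix t :: real assume t: "0 < t"
  define e where "e = G (z + t *\<^sub>R h) - G z - H z *v (t *\<^sub>R h)"
  have "\<mu> * (t\<^sup>2 * (norm h)\<^sup>2) \<le> (G (z + t *\<^sub>R h) - G z) \<bullet> (t *\<^sub>R h)"
    using strongly_convex_monotone[OF assms, of "z + t *\<^sub>R h" z]
    by (simp add: power_mult_distrib)
  also have "G (z + t *\<^sub>R h) - G z = t *\<^sub>R (H z *v h) + e"
    by (simp add: e_def matrix_vector_mult_scaleR)
  also have "(t *\<^sub>R (H z *v h) + e) \<bullet> (t *\<^sub>R h) = t\<^sup>2 * ((H z *v h) \<bullet> h) + t * (e \<bullet> h)"
    by (simp add: inner_add_left power2_eq_square distrib_left)
  finally have lower: "\<mu> * (t\<^sup>2 * (norm h)\<^sup>2) \<le> t\<^sup>2 * ((H z *v h) \<bullet> h) + t * (e \<bullet> h)" .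
  have "e \<bullet> h \<le> (M / 2 * (norm (t *\<^sub>R h))\<^sup>2) * norm h"
    unfolding e_def
    by (rule order_trans[OF norm_cauchy_schwarz]) (intro mult_right_mono taylor_grad norm_ge_zero)
  then have "t * (e \<bullet> h) \<le> t * ((M / 2 * (norm (t *\<^sub>R h))\<^sup>2) * norm h)"
    using t by (intro mult_left_mono) auto
  also have "\<dots> = t\<^sup>2 * (t * (M / 2 * norm h ^ 3))"
    by (simp add: power2_eq_square power3_eq_cube)
  finally have "t\<^sup>2 * (\<mu> * (norm h)\<^sup>2) \<le> t\<^sup>2 * ((H z *v h) \<bullet> h + t * (M / 2 * norm h ^ 3))"
    using lower by (simp add: distrib_left mult.left_commute)
  then show "\<mu> * (norm h)\<^sup>2 \<le> (H z *v h) \<bullet> h + t * (M / 2 * norm h ^ 3)"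
    using t by simp
qed

end

section \<open>The cubic-regularized Newton step\<close>

lemma has_derivative_norm_cube:
  fixes x :: "'a::real_inner"
  shows "((\<lambda>z. norm z ^ 3) has_derivative (\<lambda>d. 3 * norm x * (x \<bullet> d))) (at x)"
proof (cases "x = 0")
  case True
  have "((\<lambda>z. norm z ^ 3) has_derivative (\<lambda>d. 0)) (at (0::'a))"
  proof (rule has_derivativeI_sandwich[where e = 1 and H = "\<lambda>y. (norm y)\<^sup>2"])
    show "((\<lambda>y. (norm y)\<^sup>2) \<longlongrightarrow> 0) (at (0::'a))"
      by (auto intro!: tendsto_eq_intros)
  qed (auto simp: power2_eq_square power3_eq_cube)
  with True show ?thesis by simp
next
  case False
  have "((\<lambda>z. norm z ^ 3) has_derivative (\<lambda>d. 3 * (d \<bullet> sgn x) * (norm x)\<^sup>2)) (at x)"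
    using False by (auto intro!: derivative_eq_intros has_derivative_norm)
  moreover have "3 * (d \<bullet> sgn x) * (norm x)\<^sup>2 = 3 * norm x * (x \<bullet> d)" for d
    using False by (simp add: sgn_div_norm power2_eq_square inner_commute)
  ultimately show ?thesis by simp
qed

lemma cubic_model_minimizer_stationary:
  assumes min: "is_arg_min (cubic_model L \<delta> v g H) (\<lambda>_. True) (v + h)"
    and sym: "\<And>a b. (H *v a) \<bullet> b = a \<bullet> (H *v b)"
  shows "g + H *v h + (\<delta> + L / 2 * norm h) *\<^sub>R h = 0"
proof -
  define w where "w = g + H *v h + (\<delta> + L / 2 * norm h) *\<^sub>R h"
  define q where "q d = g \<bullet> d + 1/2 * ((H *v d) \<bullet> d) + \<delta> / 2 * (d \<bullet> d) + L / 6 * norm d ^ 3" for d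
  have "(q has_derivative (\<lambda>d. g \<bullet> d + 1/2 * ((H *v h) \<bullet> d + (H *v d) \<bullet> h)
      + \<delta> / 2 * (h \<bullet> d + d \<bullet> h) + L / 6 * (3 * norm h * (h \<bullet> d)))) (at h)"
    unfolding q_def
    by (intro derivative_intros has_derivative_norm_cube has_derivative_inner
        bounded_linear_imp_has_derivative[OF matrix_vector_mul_bounded_linear])
  moreover have "g \<bullet> d + 1/2 * ((H *v h) \<bullet> d + (H *v d) \<bullet> h)
      + \<delta> / 2 * (h \<bullet> d + d \<bullet> h) + L / 6 * (3 * norm h * (h \<bullet> d)) = w \<bullet> d" for d
  proof -
    have "(H *v d) \<bullet> h = (H *v h) \<bullet> d" by (simp only: sym[of d h] inner_commute[of d])
    then show ?thesis by (simp add: w_def inner_commute[of d h] inner_add_left algebra_simps)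
  qed
  ultimately have deriv: "(q has_derivative (\<lambda>d. w \<bullet> d)) (at h)" by (simp only:)
  have "\<forall>d\<in>UNIV. q h \<le> q d"
  proof
    fix d
    have "cubic_model L \<delta> v g H (v + h) \<le> cubic_model L \<delta> v g H (v + d)"
      using min by (auto simp: is_arg_min_def not_less)
    then show "q h \<le> q d" by (simp add: cubic_model_def q_def power2_norm_eq_inner)
  qed
  then have "(\<lambda>d. w \<bullet> d) = (\<lambda>d. 0)"
    by (intro differential_zero_maxmin[OF UNIV_I open_UNIV deriv] disjI2)
  then have "w \<bullet> w = 0" by (rule fun_cong)
  then show ?thesis by (simp add: w_def)
qed

lemma norm_scaled_self_monotone:
  fixes a b :: "'a::real_inner"
  shows "0 \<le> (norm a *\<^sub>R a - norm b *\<^sub>R b) \<bullet> (a - b)"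
proof -
  have "(norm a + norm b) * (a \<bullet> b) \<le> (norm a + norm b) * (norm a * norm b)"
    by (intro mult_left_mono norm_cauchy_schwarz) simp
  moreover have "0 \<le> (norm a + norm b) * (norm a - norm b)\<^sup>2" by simp
  moreover have "(norm a *\<^sub>R a - norm b *\<^sub>R b) \<bullet> (a - b)
      = norm a * (norm a)\<^sup>2 + norm b * (norm b)\<^sup>2 - (norm a + norm b) * (a \<bullet> b)"
    by (simp add: power2_norm_eq_inner inner_diff_left inner_diff_right inner_commute[of b a]
        algebra_simps)
  ultimately show ?thesis by (simp add: power2_eq_square algebra_simps)
qed

text \<open>The map \<open>\<lambda>h. g + H *v h + (\<delta> + L * norm h) *\<^sub>R h\<close> is strongly monotone as soon as \<open>H\<close> is bounded below,
because \<open>\<lambda>h. norm h *\<^sub>R h\<close> is monotone. Its zeros therefore depend on the data in a Lipschitz way; this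
bounds the disagreement between the cubic steps of two nodes.\<close>

lemma cubic_stationary_perturbation:
  fixes H1 H2 :: "real^'d^'d"
  assumes st1: "g1 + H1 *v h1 + (\<delta> + L * norm h1) *\<^sub>R h1 = 0"
    and st2: "g2 + H2 *v h2 + (\<delta> + L * norm h2) *\<^sub>R h2 = 0"
    and H1: "\<And>a. c * (norm a)\<^sup>2 \<le> (H1 *v a) \<bullet> a"
    and "0 \<le> \<delta>" "0 \<le> L"
  shows "c * norm (h1 - h2) \<le> norm (g1 - g2) + norm ((H1 - H2) *v h2)"
proof -
  let ?d = "h1 - h2" and ?r = "(g1 - g2) + (H1 - H2) *v h2"
  have eq: "H1 *v ?d + \<delta> *\<^sub>R ?d + L *\<^sub>R (norm h1 *\<^sub>R h1 - norm h2 *\<^sub>R h2) = - ?r"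
  proof -
    have "H1 *v ?d + \<delta> *\<^sub>R ?d + L *\<^sub>R (norm h1 *\<^sub>R h1 - norm h2 *\<^sub>R h2) + ?r
      = (g1 + H1 *v h1 + (\<delta> + L * norm h1) *\<^sub>R h1)
        - (g2 + H2 *v h2 + (\<delta> + L * norm h2) *\<^sub>R h2)"
      by (simp add: matrix_vector_mult_diff_distrib matrix_vector_mult_diff_rdistrib
          scaleR_add_left scaleR_diff_right)
    also have "\<dots> = 0" by (simp only: st1 st2 diff_self)
    finally show ?thesis by (simp only: eq_neg_iff_add_eq_0)
  qed
  have "c * (norm ?d)\<^sup>2 \<le> (H1 *v ?d) \<bullet> ?d" by (rule H1)
  also have "\<dots> \<le> (H1 *v ?d) \<bullet> ?d + \<delta> * (?d \<bullet> ?d)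
      + L * ((norm h1 *\<^sub>R h1 - norm h2 *\<^sub>R h2) \<bullet> ?d)"
    using assms norm_scaled_self_monotone[of h1 h2] by simp
  also have "\<dots> = - ?r \<bullet> ?d"
    unfolding eq[symmetric] by (simp only: inner_add_left inner_scaleR_left)
  also have "\<dots> \<le> norm ?r * norm ?d"
    using norm_cauchy_schwarz[of "- ?r" ?d] by (simp only: norm_minus_cancel)
  also have "\<dots> \<le> (norm (g1 - g2) + norm ((H1 - H2) *v h2)) * norm ?d"
    by (intro mult_right_mono norm_triangle_ineq) simp
  finally have "c * norm ?d * norm ?d \<le> (norm (g1 - g2) + norm ((H1 - H2) *v h2)) * norm ?d"
    by (simp add: power2_eq_square)
  then show ?thesis by (cases "h1 = h2") (auto simp: mult_le_cancel_right)
qed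

text \<open>A vector in the sum of two centred balls is a sum of elements of the balls. This splits the gradient
error off the residual of a cubic step, so that the main estimate can be proved without it.\<close>

lemma norm_split_le_add:
  fixes w :: "'a::real_normed_vector"
  assumes "norm w \<le> r + s" "0 \<le> r" "0 \<le> s"
  shows "\<exists>e. norm e \<le> s \<and> norm (w - e) \<le> r"
proof (cases "r + s = 0")
  case True
  with assms show ?thesis by (intro exI[of _ 0]) auto
next
  case False
  with assms have pos: "r + s > 0" by auto
  define e where "e = (s / (r + s)) *\<^sub>R w"
  have "w - e = (r / (r + s)) *\<^sub>R w"
  proof -
    have "r / (r + s) = 1 - s / (r + s)" using pos by (simp add: field_simps)
    then show ?thesis by (simp only: e_def scaleR_diff_left scaleR_one)
  qed
  then have "norm (w - e) = r * (norm w / (r + s))" using assms pos by simp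
  also have "\<dots> \<le> r" using assms pos by (intro mult_left_le) simp_all
  finally have we: "norm (w - e) \<le> r" .
  have "norm e = s * (norm w / (r + s))" using assms pos by (simp add: e_def)
  also have "\<dots> \<le> s" using assms pos by (intro mult_left_le) simp_all
  finally show ?thesis using we by blast
qed

text \<open>The factors 3 in the model are chosen for this estimate: the Taylor remainder \<open>M / 2 * (norm h)\<^sup>2\<close>
and the Hessian error \<open>D2 * norm h\<close> add up to exactly a third of the regularization force
\<open>\<zeta> * norm h\<close>.\<close>

lemma (in lipschitz_hessian) inexact_cubic_step_residual:
  assumes st: "g + K *v h + (3 * D2 + 3 * M / 2 * norm h) *\<^sub>R h = 0"
    and g: "norm (g - G v) \<le> D1"
    and K: "norm ((K - H v) *v h) \<le> D2 * norm h"
    and \<zeta>: "\<zeta> = 3 * D2 + 3 * M / 2 * norm h"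
  shows "norm (G (v + h) + \<zeta> *\<^sub>R h) \<le> \<zeta> * norm h / 3 + D1"
proof -
  let ?t = "G (v + h) - G v - H v *v h"
  have "g + K *v h + \<zeta> *\<^sub>R h = 0" unfolding \<zeta> by (rule st)
  then have "G (v + h) + \<zeta> *\<^sub>R h = ?t - (g - G v) - (K - H v) *v h"
    by (simp add: matrix_vector_mult_diff_rdistrib add_eq_0_iff algebra_simps)
  also have "norm \<dots> \<le> norm ?t + norm (g - G v) + norm ((K - H v) *v h)"
    using norm_triangle_ineq4[of "?t - (g - G v)" "(K - H v) *v h"]
      norm_triangle_ineq4[of ?t "g - G v"] by linarith
  also have "\<dots> \<le> M / 2 * (norm h)\<^sup>2 + D1 + D2 * norm h"
    by (intro add_mono taylor_grad g K)
  also have "\<dots> = \<zeta> * norm h / 3 + D1"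
    by (simp add: \<zeta> power2_eq_square algebra_simps)
  finally show ?thesis .
qed

text \<open>Squaring the residual bound gives \<open>\<zeta> * (- (b \<bullet> h)) \<ge> 3 / 4 * (norm b)\<^sup>2\<close>. If the Hessian error
dominates \<open>\<zeta>\<close>, the progress is quadratic in \<open>norm b\<close> and Young's inequality with exponent 2 absorbs
\<open>\<alpha> * (b \<bullet> d)\<close> into a quadratic term in \<open>d\<close>. Otherwise \<open>\<zeta>\<close> is of order \<open>norm h\<close>, hence of order
\<open>sqrt (norm b)\<close>, the progress has order \<open>norm b powr (3 / 2)\<close>, and Young's inequality with exponents
\<open>3 / 2\<close> and \<open>3\<close> needs a cubic term in \<open>d\<close>. Only one of the two terms is needed at a time, so both
hypotheses may use the same \<open>P\<close>.\<close>

lemma cubic_step_progress_exact: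
  fixes b h d :: "'a::real_inner"
  assumes res: "norm (b + \<zeta> *\<^sub>R h) \<le> \<zeta> * norm h / 3"
    and \<zeta>: "\<zeta> = 3 * D2 + 3 * M / 2 * norm h"
    and pos: "0 \<le> D2" "0 < M" "0 \<le> \<alpha>"
    and quadratic: "2 * \<alpha>\<^sup>2 * D2 * (norm d)\<^sup>2 \<le> P"
    and cubic: "32 / 27 * M * \<alpha> ^ 3 * norm d ^ 3 \<le> P"
  shows "0 \<le> - (b \<bullet> h) + \<alpha> * (b \<bullet> d) + P"
proof -
  define s B D t where "s = norm h" and "B = norm b" and "D = norm d" and "t = - (b \<bullet> h)"
  have nn: "0 \<le> s" "0 \<le> B" "0 \<le> D" "0 \<le> \<zeta>" using pos by (auto simp: s_def B_def D_def \<zeta>)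
  have P: "0 \<le> P"
    using quadratic pos by (meson mult_nonneg_nonneg order_trans zero_le_numeral zero_le_power2)
  have upper: "B \<le> 4 / 3 * (\<zeta> * s)"
    using norm_triangle_ineq4[of "b + \<zeta> *\<^sub>R h" "\<zeta> *\<^sub>R h"] res nn by (simp add: B_def s_def)
  have lower: "2 / 3 * (\<zeta> * s) \<le> B"
    using norm_triangle_ineq4[of "b + \<zeta> *\<^sub>R h" b] res nn by (simp add: B_def s_def)
  have "(norm (b + \<zeta> *\<^sub>R h))\<^sup>2 \<le> (\<zeta> * norm h / 3)\<^sup>2"
    using res by (intro power_mono) auto
  then have "B\<^sup>2 - 2 * (\<zeta> * t) + (\<zeta> * s)\<^sup>2 \<le> (\<zeta> * s)\<^sup>2 / 9"
    by (simp add: power2_norm_eq_inner inner_add_left inner_add_right B_def s_def t_def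
        inner_commute[of h b] power_mult_distrib power_divide)
      (simp add: power2_eq_square algebra_simps)
  moreover have "B\<^sup>2 \<le> (4 / 3 * (\<zeta> * s))\<^sup>2" using upper nn by (intro power_mono) auto
  then have "B\<^sup>2 \<le> 16 / 9 * (\<zeta> * s)\<^sup>2" by (simp only: power_mult_distrib) (simp add: power_divide)
  ultimately have prog: "3 / 4 * B\<^sup>2 \<le> \<zeta> * t" by linarith
  have inner: "- (B * D) \<le> b \<bullet> d"
    using norm_cauchy_schwarz[of "- b" d] by (simp add: B_def D_def)
  have main: "\<alpha> * (B * D) \<le> t + P"
  proof (cases "\<zeta> = 0")
    case True
    with prog have B0: "B = 0" by simp
    then have "t = 0" by (simp add: B_def t_def)
    with B0 P show ?thesis by simp
  next
    case False
    with nn have z: "0 < \<zeta>" by simp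
    have "0 \<le> \<zeta> * t" using prog zero_le_power2[of B] by linarith
    then have t0: "0 \<le> t" using z by (simp add: zero_le_mult_iff)
    show ?thesis
    proof (cases "3 * M / 2 * s \<le> 3 * D2")
      case True
      then have "\<zeta> \<le> 6 * D2" by (simp add: \<zeta> s_def)
      have "0 \<le> 3 / 4 * (B - 2 / 3 * \<alpha> * \<zeta> * D)\<^sup>2" by simp
      also have "\<dots> = 3 / 4 * B\<^sup>2 - \<zeta> * (\<alpha> * (B * D)) + \<zeta> * (\<alpha>\<^sup>2 * D\<^sup>2 * (\<zeta> / 3))"
        by (simp add: power2_eq_square algebra_simps)
      also have "\<dots> \<le> \<zeta> * t - \<zeta> * (\<alpha> * (B * D)) + \<zeta> * (\<alpha>\<^sup>2 * D\<^sup>2 * (\<zeta> / 3))"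
        using prog by simp
      finally have "\<zeta> * (\<alpha> * (B * D)) \<le> \<zeta> * (t + \<alpha>\<^sup>2 * D\<^sup>2 * (\<zeta> / 3))"
        by (simp add: distrib_left)
      then have "\<alpha> * (B * D) \<le> t + \<alpha>\<^sup>2 * D\<^sup>2 * (\<zeta> / 3)" using z by simp
      also have "\<alpha>\<^sup>2 * D\<^sup>2 * (\<zeta> / 3) \<le> \<alpha>\<^sup>2 * D\<^sup>2 * (2 * D2)"
        using \<open>\<zeta> \<le> 6 * D2\<close> by (intro mult_left_mono) auto
      also have "\<dots> \<le> P" using quadratic by (simp add: D_def mult_ac)
      finally show ?thesis by simp
    next
      case False
      then have zs: "\<zeta> \<le> 3 * M * s" by (simp add: \<zeta> s_def)
      \<comment> \<open>Writing \<open>B = 8 * M * w\<^sup>2\<close> turns the fractional powers of \<open>B\<close> into integer powers of \<open>w\<close>; the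
        factor 8 makes the progress exactly \<open>8 * M * w ^ 3\<close>.\<close>
      define w where "w = sqrt (B / (8 * M))"
      have w: "0 \<le> w" and Bw: "B = 8 * M * w\<^sup>2" using nn pos by (auto simp: w_def)
      have "\<zeta>\<^sup>2 \<le> 3 * M * (\<zeta> * s)" using mult_left_mono[OF zs, of \<zeta>] nn
        by (simp add: power2_eq_square mult_ac)
      also have "\<dots> \<le> 3 * M * (3 / 2 * B)" using lower pos by (intro mult_left_mono) auto
      also have "\<dots> = (6 * M * w)\<^sup>2" by (simp add: Bw power2_eq_square)
      finally have "\<zeta>\<^sup>2 \<le> (6 * M * w)\<^sup>2" .
      then have zw: "\<zeta> \<le> 6 * M * w"
        by (rule power2_le_imp_le) (simp add: w pos less_imp_le)
      have wpos: "0 < w"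
      proof (rule ccontr)
        assume "\<not> 0 < w"
        then have "w = 0" using w by simp
        with zw z show False by simp
      qed
      have "6 * M * w * (8 * M * w ^ 3) = 3 / 4 * B\<^sup>2"
        by (simp add: Bw power2_eq_square power3_eq_cube)
      also have "\<dots> \<le> \<zeta> * t" by (rule prog)
      also have "\<dots> \<le> 6 * M * w * t" using zw t0 by (rule mult_right_mono)
      finally have tw: "8 * M * w ^ 3 \<le> t" using pos wpos by simp
      \<comment> \<open>The minimizer of \<open>\<lambda>w. w ^ 3 - \<alpha> * D * w\<^sup>2\<close>, hence a double root below.\<close>
      define u where "u = 2 * \<alpha> * D / 3"
      have "0 \<le> 8 * M * (1 / 2 * ((w - u)\<^sup>2 * (2 * w + u)))"
        using pos w nn by (simp add: u_def)
      also have "\<dots> = 8 * M * w ^ 3 - \<alpha> * (B * D) + 32 / 27 * M * \<alpha> ^ 3 * D ^ 3"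
        by (simp add: Bw u_def power2_eq_square power3_eq_cube algebra_simps)
      finally show ?thesis using tw cubic by (simp add: D_def)
    qed
  qed
  have "\<alpha> * (- (B * D)) \<le> \<alpha> * (b \<bullet> d)" using inner pos by (intro mult_left_mono) auto
  with main show ?thesis by (simp add: t_def)
qed

lemma cubic_step_progress:
  fixes a h d :: "'a::real_inner"
  assumes res: "norm (a + \<zeta> *\<^sub>R h) \<le> \<zeta> * norm h / 3 + D1"
    and \<zeta>: "\<zeta> = 3 * D2 + 3 * M / 2 * norm h"
    and pos: "0 \<le> D1" "0 \<le> D2" "0 < M" "0 \<le> \<alpha>"
    and quadratic: "2 * \<alpha>\<^sup>2 * D2 * (norm d)\<^sup>2 \<le> P"
    and cubic: "32 / 27 * M * \<alpha> ^ 3 * norm d ^ 3 \<le> P"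
  shows "- D1 * (norm h + \<alpha> * norm d) \<le> - (a \<bullet> h) + \<alpha> * (a \<bullet> d) + P"
proof -
  have "0 \<le> \<zeta> * norm h / 3" using pos by (simp add: \<zeta>)
  from norm_split_le_add[OF res this pos(1)] obtain e
    where e: "norm e \<le> D1" "norm (a - e + \<zeta> *\<^sub>R h) \<le> \<zeta> * norm h / 3"
    by (auto simp: algebra_simps)
  have "0 \<le> - ((a - e) \<bullet> h) + \<alpha> * ((a - e) \<bullet> d) + P"
    by (rule cubic_step_progress_exact[OF e(2) \<zeta> pos(2-4) quadratic cubic])
  moreover have "- (D1 * norm h) \<le> - (e \<bullet> h)"
    using norm_cauchy_schwarz[of e h] mult_right_mono[OF e(1), of "norm h"] by simp
  moreover have "\<alpha> * (- (D1 * norm d)) \<le> \<alpha> * (e \<bullet> d)"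
    using norm_cauchy_schwarz[of "- e" d] mult_right_mono[OF e(1), of "norm d"] pos
    by (intro mult_left_mono) auto
  ultimately show ?thesis by (simp add: inner_diff_left algebra_simps)
qed

text \<open>The regularization makes the model an upper bound of \<open>f\<close> at \<open>x\<close>, up to the gradient error, and
minimality compares it with the model at \<open>z\<close>. It is used for the first step only, to bound the initial
potential in terms of the distance to the optimum.\<close>

lemma (in lipschitz_hessian) inexact_cubic_step_value:
  assumes min: "is_arg_min (cubic_model (3 * M) (3 * D2) v g K) (\<lambda>_. True) x"
    and g: "norm (g - G v) \<le> D1"
    and K: "\<And>h. norm ((K - H v) *v h) \<le> D2 * norm h"
    and pos: "0 \<le> D2" "0 \<le> M"
  shows "f x \<le> f z + D1 * (norm (x - v) + norm (z - v)) + 2 * D2 * (norm (z - v))\<^sup>2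
    + 2 / 3 * M * norm (z - v) ^ 3"
proof -
  define m where "m d = g \<bullet> d + 1/2 * ((K *v d) \<bullet> d)" for d
  have model: "cubic_model (3 * M) (3 * D2) v g K u
      = m (u - v) + 3 * D2 / 2 * (norm (u - v))\<^sup>2 + M / 2 * norm (u - v) ^ 3" for u
    by (simp add: cubic_model_def m_def)
  have approx: "\<bar>f u - f v - m (u - v)\<bar>
      \<le> D1 * norm (u - v) + D2 / 2 * (norm (u - v))\<^sup>2 + M / 6 * norm (u - v) ^ 3" for u
  proof -
    let ?d = "u - v"
    have t: "\<bar>f u - f v - G v \<bullet> ?d - 1/2 * ((H v *v ?d) \<bullet> ?d)\<bar> \<le> M / 6 * norm ?d ^ 3"
      using taylor_fun[of v ?d] by simp
    have "\<bar>(g - G v) \<bullet> ?d\<bar> \<le> norm (g - G v) * norm ?d" by (rule Cauchy_Schwarz_ineq2)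
    also have "\<dots> \<le> D1 * norm ?d" by (intro mult_right_mono g) simp
    finally have a: "\<bar>(g - G v) \<bullet> ?d\<bar> \<le> D1 * norm ?d" .
    have "\<bar>((K - H v) *v ?d) \<bullet> ?d\<bar> \<le> norm ((K - H v) *v ?d) * norm ?d"
      by (rule Cauchy_Schwarz_ineq2)
    also have "\<dots> \<le> (D2 * norm ?d) * norm ?d" by (intro mult_right_mono K) simp
    finally have b: "\<bar>((K - H v) *v ?d) \<bullet> ?d\<bar> \<le> D2 * (norm ?d)\<^sup>2"
      by (simp add: power2_eq_square)
    have "f u - f v - m ?d = (f u - f v - G v \<bullet> ?d - 1/2 * ((H v *v ?d) \<bullet> ?d))
        - (g - G v) \<bullet> ?d - 1/2 * (((K - H v) *v ?d) \<bullet> ?d)"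
      by (simp add: m_def inner_diff_left matrix_vector_mult_diff_rdistrib diff_divide_distrib)
    with t a b show ?thesis by linarith
  qed
  have "cubic_model (3 * M) (3 * D2) v g K x \<le> cubic_model (3 * M) (3 * D2) v g K z"
    using min by (auto simp: is_arg_min_def not_less)
  moreover have "0 \<le> D2 * (norm (x - v))\<^sup>2" "0 \<le> M * norm (x - v) ^ 3" using pos by auto
  moreover note abs_le_D1[OF approx[of x]] abs_le_D2[OF approx[of z]]
  ultimately show ?thesis unfolding model distrib_left by linarith
qed

section \<open>Strong convexity and estimating functions\<close>

lemma strongly_convex_add:
  assumes "strongly_convex a \<phi>" "strongly_convex b \<psi>"
  shows "strongly_convex (a + b) (\<lambda>z. \<phi> z + \<psi> z)"
  unfolding strongly_convex_def
proof (intro allI ballI)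
  fix y z :: "real^'a" and t :: real assume "t \<in> {0..1}"
  with assms have
    "\<phi> ((1 - t) *\<^sub>R y + t *\<^sub>R z)
      \<le> (1 - t) * \<phi> y + t * \<phi> z - a / 2 * t * (1 - t) * (norm (y - z))\<^sup>2"
    "\<psi> ((1 - t) *\<^sub>R y + t *\<^sub>R z)
      \<le> (1 - t) * \<psi> y + t * \<psi> z - b / 2 * t * (1 - t) * (norm (y - z))\<^sup>2"
    unfolding strongly_convex_def by blast+
  then show "\<phi> ((1 - t) *\<^sub>R y + t *\<^sub>R z) + \<psi> ((1 - t) *\<^sub>R y + t *\<^sub>R z)
      \<le> (1 - t) * (\<phi> y + \<psi> y) + t * (\<phi> z + \<psi> z)
        - (a + b) / 2 * t * (1 - t) * (norm (y - z))\<^sup>2"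
    by (simp add: algebra_simps add_divide_distrib)
qed

lemma strongly_convex_cmult:
  assumes "strongly_convex a \<phi>" "0 \<le> c"
  shows "strongly_convex (c * a) (\<lambda>z. c * \<phi> z)"
  unfolding strongly_convex_def
proof (intro allI ballI)
  fix y z :: "real^'a" and t :: real assume "t \<in> {0..1}"
  with assms(1) have
    "\<phi> ((1 - t) *\<^sub>R y + t *\<^sub>R z)
      \<le> (1 - t) * \<phi> y + t * \<phi> z - a / 2 * t * (1 - t) * (norm (y - z))\<^sup>2"
    unfolding strongly_convex_def by blast
  from mult_left_mono[OF this assms(2)]
  show "c * \<phi> ((1 - t) *\<^sub>R y + t *\<^sub>R z)
      \<le> (1 - t) * (c * \<phi> y) + t * (c * \<phi> z) - c * a / 2 * t * (1 - t) * (norm (y - z))\<^sup>2"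
    by (simp add: algebra_simps)
qed

lemma strongly_convex_quadratic:
  "strongly_convex c (\<lambda>z. b + g \<bullet> (z - p) + c / 2 * (norm (z - q))\<^sup>2)"
  unfolding strongly_convex_def
proof (intro allI ballI)
  fix y z :: "real^'a" and t :: real
  define u w where "u = y - q" and "w = z - q"
  have lin: "(1 - t) *\<^sub>R y + t *\<^sub>R z - p = (1 - t) *\<^sub>R (y - p) + t *\<^sub>R (z - p)"
    "(1 - t) *\<^sub>R y + t *\<^sub>R z - q = (1 - t) *\<^sub>R u + t *\<^sub>R w" "y - z = u - w"
    by (simp_all add: u_def w_def algebra_simps)
  have sq: "(norm ((1 - t) *\<^sub>R u + t *\<^sub>R w))\<^sup>2
      = (1 - t) * (norm u)\<^sup>2 + t * (norm w)\<^sup>2 - t * (1 - t) * (norm (u - w))\<^sup>2"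
    by (simp add: power2_norm_eq_inner inner_add_left inner_add_right inner_diff_left
        inner_diff_right inner_commute[of w u] algebra_simps)
  show "b + g \<bullet> ((1 - t) *\<^sub>R y + t *\<^sub>R z - p) + c / 2 * (norm ((1 - t) *\<^sub>R y + t *\<^sub>R z - q))\<^sup>2
      \<le> (1 - t) * (b + g \<bullet> (y - p) + c / 2 * (norm (y - q))\<^sup>2)
        + t * (b + g \<bullet> (z - p) + c / 2 * (norm (z - q))\<^sup>2)
        - c / 2 * t * (1 - t) * (norm (y - z))\<^sup>2"
    unfolding lin sq u_def[symmetric] w_def[symmetric] inner_add_right inner_scaleR_right
    by (simp add: algebra_simps add_divide_distrib diff_divide_distrib)
qed

lemma strongly_convex_norm_cube: "strongly_convex 0 (\<lambda>z. norm (z - q) ^ 3)"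
  unfolding strongly_convex_def
proof (intro allI ballI)
  fix y z :: "real^'a" and t :: real assume t: "t \<in> {0..1}"
  define a b where "a = norm (y - q)" and "b = norm (z - q)"
  have nn: "0 \<le> a" "0 \<le> b" by (simp_all add: a_def b_def)
  have "(1 - t) *\<^sub>R y + t *\<^sub>R z - q = (1 - t) *\<^sub>R (y - q) + t *\<^sub>R (z - q)"
    by (simp add: algebra_simps)
  then have "norm ((1 - t) *\<^sub>R y + t *\<^sub>R z - q) \<le> (1 - t) * a + t * b"
    using t norm_triangle_ineq[of "(1 - t) *\<^sub>R (y - q)" "t *\<^sub>R (z - q)"]
    by (simp add: a_def b_def)
  then have "norm ((1 - t) *\<^sub>R y + t *\<^sub>R z - q) ^ 3 \<le> ((1 - t) * a + t * b) ^ 3"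
    by (intro power_mono) auto
  also have "\<dots> \<le> (1 - t) * a ^ 3 + t * b ^ 3"
  proof -
    \<comment> \<open>The convexity gap of the cube, factored: \<open>a = b\<close> is a double zero.\<close>
    have "0 \<le> t * (1 - t) * ((a - b)\<^sup>2 * ((2 - t) * a + (1 + t) * b))"
      using t nn by (intro mult_nonneg_nonneg add_nonneg_nonneg) auto
    also have "\<dots> = (1 - t) * a ^ 3 + t * b ^ 3 - ((1 - t) * a + t * b) ^ 3"
      by (simp add: power2_eq_square power3_eq_cube algebra_simps)
    finally show ?thesis by simp
  qed
  finally show "norm ((1 - t) *\<^sub>R y + t *\<^sub>R z - q) ^ 3
      \<le> (1 - t) * norm (y - q) ^ 3 + t * norm (z - q) ^ 3
        - 0 / 2 * t * (1 - t) * (norm (y - z))\<^sup>2"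
    by (simp add: a_def b_def)
qed

lemma strongly_convex_node_mean:
  fixes \<phi> :: "'m::finite \<Rightarrow> real^'a \<Rightarrow> real"
  assumes "\<And>i. strongly_convex (\<mu> i) (\<phi> i)"
  shows "strongly_convex (node_mean \<mu>) (\<lambda>z. node_mean (\<lambda>i. \<phi> i z))"
  unfolding strongly_convex_def
proof (intro allI ballI)
  fix y z :: "real^'a" and t :: real assume t: "t \<in> {0..1}"
  have "node_mean (\<lambda>i. \<phi> i ((1 - t) *\<^sub>R y + t *\<^sub>R z))
      \<le> node_mean (\<lambda>i. (1 - t) * \<phi> i y + t * \<phi> i z
          - \<mu> i * (1 / 2 * t * (1 - t) * (norm (y - z))\<^sup>2))"
  proof (rule node_mean_mono)
    fix i
    show "\<phi> i ((1 - t) *\<^sub>R y + t *\<^sub>R z)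
      \<le> (1 - t) * \<phi> i y + t * \<phi> i z - \<mu> i * (1 / 2 * t * (1 - t) * (norm (y - z))\<^sup>2)"
      using assms[of i] t by (simp add: strongly_convex_def mult.assoc)
  qed
  then show "node_mean (\<lambda>i. \<phi> i ((1 - t) *\<^sub>R y + t *\<^sub>R z))
      \<le> (1 - t) * node_mean (\<lambda>i. \<phi> i y) + t * node_mean (\<lambda>i. \<phi> i z)
        - node_mean \<mu> / 2 * t * (1 - t) * (norm (y - z))\<^sup>2"
    by (simp only: node_mean_add node_mean_diff node_mean_cmult node_mean_mult_right)
qed

lemma strongly_convex_minimizer_growth:
  assumes sc: "strongly_convex c \<phi>" and min: "is_arg_min \<phi> (\<lambda>_. True) y"
  shows "\<phi> y + c / 2 * (norm (z - y))\<^sup>2 \<le> \<phi> z"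
proof (rule le_if_le_add_small)
  fix t :: real assume t: "0 < t" "t < 1"
  have "\<phi> y \<le> \<phi> ((1 - t) *\<^sub>R y + t *\<^sub>R z)"
    using min by (auto simp: is_arg_min_def not_less)
  also have "\<dots> \<le> (1 - t) * \<phi> y + t * \<phi> z - c / 2 * t * (1 - t) * (norm (y - z))\<^sup>2"
    using sc t unfolding strongly_convex_def by auto
  finally have "t * (\<phi> y + c / 2 * (norm (y - z))\<^sup>2)
      \<le> t * (\<phi> z + t * (c / 2 * (norm (y - z))\<^sup>2))"
    by (simp add: algebra_simps diff_divide_distrib)
  then show "\<phi> y + c / 2 * (norm (z - y))\<^sup>2 \<le> \<phi> z + t * (c / 2 * (norm (y - z))\<^sup>2)"
    using t by (simp add: norm_minus_commute[of z y])
qed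

lemma A_seq_Suc: "A_seq \<alpha> (Suc k) = A_seq \<alpha> k * (1 - \<alpha> (Suc k))"
  by (simp add: A_seq_def)

text \<open>Each linear-quadratic piece has modulus \<open>\<mu> * \<alpha> k / A_seq \<alpha> k\<close>, and these weights telescope because
\<open>\<alpha> k / A_seq \<alpha> k = 1 / A_seq \<alpha> k - 1 / A_seq \<alpha> (k - 1)\<close>. With constant \<open>\<kappa>2\<close> and \<open>\<kappa>3\<close> no further
multiples of the anchor terms are added, and the cubic anchor term is convex.\<close>

lemma est_fun_strongly_convex:
  assumes \<alpha>: "\<And>j. 1 \<le> j \<Longrightarrow> j \<le> k \<Longrightarrow> 0 \<le> \<alpha> j \<and> \<alpha> j < 1"
    and \<kappa>2: "\<And>j. j \<le> k \<Longrightarrow> \<kappa>2 j = a" and \<kappa>3: "\<And>j. j \<le> k \<Longrightarrow> \<kappa>3 j = b" and "0 \<le> b"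
  shows "strongly_convex (a + \<mu> * (1 / A_seq \<alpha> k - 1)) (est_fun f \<kappa>2 \<kappa>3 \<alpha> \<mu> p x g (Suc k))"
  using \<alpha> \<kappa>2 \<kappa>3
proof (induction k)
  case 0
  have "strongly_convex (a + b / 6 * 0)
      (\<lambda>z. (f (x 1) + 0 \<bullet> (z - p) + a / 2 * (norm (z - p))\<^sup>2) + b / 6 * norm (z - p) ^ 3)"
    using \<open>0 \<le> b\<close>
    by (intro strongly_convex_add strongly_convex_cmult strongly_convex_quadratic
        strongly_convex_norm_cube) simp
  moreover have "est_fun f \<kappa>2 \<kappa>3 \<alpha> \<mu> p x g (Suc 0)
      = (\<lambda>z. (f (x 1) + 0 \<bullet> (z - p) + a / 2 * (norm (z - p))\<^sup>2) + b / 6 * norm (z - p) ^ 3)"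
    by (rule ext) (simp add: 0)
  ultimately show ?case by (simp add: A_seq_def)
next
  case (Suc k)
  let ?E = "est_fun f \<kappa>2 \<kappa>3 \<alpha> \<mu> p x g" and ?r = "\<alpha> (Suc k) / A_seq \<alpha> (Suc k)"
  have pos: "0 < A_seq \<alpha> j" if "j \<le> Suc k" for j
    unfolding A_seq_def using that Suc.prems(1) by (intro prod_pos) auto
  have eq: "?E (Suc (Suc k)) = (\<lambda>z. ?E (Suc k) z + ?r * (f (x (k + 2)) + g (k + 2) \<bullet> (z - x (k + 2))
      + \<mu> / 2 * (norm (z - x (k + 2)))\<^sup>2))"
    by (rule ext, subst est_fun.simps) (simp add: Suc.prems)
  have "strongly_convex (a + \<mu> * (1 / A_seq \<alpha> k - 1) + ?r * \<mu>) (?E (Suc (Suc k)))"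
    unfolding eq
  proof (intro strongly_convex_add strongly_convex_cmult strongly_convex_quadratic)
    show "strongly_convex (a + \<mu> * (1 / A_seq \<alpha> k - 1)) (?E (Suc k))"
      by (rule Suc.IH) (use Suc.prems in auto)
    show "0 \<le> ?r" using Suc.prems(1)[of "Suc k"] pos[of "Suc k"] by simp
  qed
  also have "a + \<mu> * (1 / A_seq \<alpha> k - 1) + ?r * \<mu> = a + \<mu> * (1 / A_seq \<alpha> (Suc k) - 1)"
    using pos[of k] Suc.prems(1)[of "Suc k"] by (simp add: A_seq_Suc field_simps)
  finally show ?case .
qed

section \<open>Averaged objectives\<close>

lemma lipschitz_hessian_gradient_hessian:
  assumes f: "twice_differentiable f"
    and lip: "\<And>z w. op_norm (hessian f z - hessian f w) \<le> M * norm (z - w)"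
  shows "lipschitz_hessian f (gradient f) (hessian f) M"
proof
  fix z w h
  from f obtain f' where f': "(f has_derivative f') (at z)"
    by (auto simp: twice_differentiable_def differentiable_def)
  have "f' = (\<lambda>h. h \<bullet> adjoint f' 1)"
    using adjoint_works[OF has_derivative_linear[OF f'], of _ 1] by auto
  with f' have D: "GDERIV f z :> adjoint f' 1" by (simp add: gderiv_def)
  moreover have "D = adjoint f' 1" if "GDERIV f z :> D" for D
  proof -
    have "(\<lambda>h. h \<bullet> D) = (\<lambda>h. h \<bullet> adjoint f' 1)"
      using that D has_derivative_unique unfolding gderiv_def by blast
    then have "(D - adjoint f' 1) \<bullet> D = (D - adjoint f' 1) \<bullet> adjoint f' 1" by (rule fun_cong)
    then have "(D - adjoint f' 1) \<bullet> (D - adjoint f' 1) = 0" by (simp add: inner_diff_right)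
    then show ?thesis by simp
  qed
  ultimately have "gradient f z = adjoint f' 1" unfolding gradient_def by (intro the_equality)
  with D show "(f has_derivative (\<lambda>h. gradient f z \<bullet> h)) (at z)"
    by (simp add: gderiv_def inner_commute)
  show "(gradient f has_derivative (\<lambda>h. hessian f z *v h)) (at z)"
    using f jacobian_works[of "gradient f" "at z"]
    by (simp add: twice_differentiable_def hessian_def)
  have "norm ((hessian f z - hessian f w) *v h) \<le> op_norm (hessian f z - hessian f w) * norm h"
    by (rule norm_matrix_vector_le_op_norm)
  also have "\<dots> \<le> (M * norm (z - w)) * norm h" by (intro mult_right_mono lip) simp
  finally show "norm ((hessian f z - hessian f w) *v h) \<le> M * norm (z - w) * norm h" .
qed

text \<open>Used with constant \<open>w\<close>, this compares an average of node derivatives at nearby points with the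
derivative of the averaged objective; with constant \<open>u\<close> and \<open>w\<close> it is the Lipschitz bound of the average.\<close>

lemma norm_node_mean_diff_le:
  fixes F :: "'m::finite \<Rightarrow> 'a::real_normed_vector \<Rightarrow> 'b::real_normed_vector"
  assumes lip: "\<And>j a b. norm (F j a - F j b) \<le> c j * norm (a - b)"
    and c: "\<And>j. 0 \<le> c j" and near: "\<And>j. norm (u j - w j) \<le> \<rho>"
  shows "norm (node_mean (\<lambda>j. F j (u j)) - node_mean (\<lambda>j. F j (w j))) \<le> node_mean c * \<rho>"
proof -
  have "norm (node_mean (\<lambda>j. F j (u j)) - node_mean (\<lambda>j. F j (w j)))
      \<le> node_mean (\<lambda>j. norm (F j (u j) - F j (w j)))"
    using norm_node_mean_le[of "\<lambda>j. F j (u j) - F j (w j)"] by (simp only: node_mean_diff)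
  also have "\<dots> \<le> node_mean (\<lambda>j. c j * \<rho>)"
    by (intro node_mean_mono order_trans[OF lip] mult_left_mono near c)
  finally show ?thesis by (simp only: node_mean_mult_right)
qed

lemma lipschitz_hessian_node_mean:
  fixes F :: "'m::finite \<Rightarrow> real^'d \<Rightarrow> real"
  assumes "\<And>i. lipschitz_hessian (F i) (G i) (H i) (M i)"
  shows "lipschitz_hessian (\<lambda>z. node_mean (\<lambda>i. F i z)) (\<lambda>z. node_mean (\<lambda>i. G i z))
    (\<lambda>z. node_mean (\<lambda>i. H i z)) (node_mean M)"
proof
  fix z w h
  interpret node: lipschitz_hessian "F i" "G i" "H i" "M i" for i by (rule assms)
  show "((\<lambda>z. node_mean (\<lambda>i. F i z)) has_derivative (\<lambda>h. node_mean (\<lambda>i. G i z) \<bullet> h)) (at z)"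
    unfolding node_mean_inner[symmetric] by (rule has_derivative_node_mean) (rule node.grad)
  show "((\<lambda>z. node_mean (\<lambda>i. G i z)) has_derivative (\<lambda>h. node_mean (\<lambda>i. H i z) *v h)) (at z)"
    unfolding node_mean_matrix_vector[symmetric]
    by (rule has_derivative_node_mean) (rule node.hess)
  have "norm (node_mean (\<lambda>i. (H i z - H i w) *v h)) \<le> node_mean (\<lambda>i. M i * (norm (z - w) * norm h))"
    using node.hess_lip
    by (intro order_trans[OF norm_node_mean_le] node_mean_mono) (simp add: mult.assoc)
  then show "norm ((node_mean (\<lambda>i. H i z) - node_mean (\<lambda>i. H i w)) *v h)
      \<le> node_mean M * norm (z - w) * norm h"
    by (simp only: node_mean_mult_right node_mean_matrix_vector node_mean_diff mult.assoc)
qed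

lemma (in lipschitz_hessian) strongly_convex_jensen:
  assumes sc: "strongly_convex \<mu> f" and "0 \<le> \<mu>"
  shows "f (node_mean u) \<le> node_mean (\<lambda>i. f (u i))"
proof -
  let ?c = "node_mean u"
  have "node_mean (\<lambda>i. f ?c + (u i - ?c) \<bullet> G ?c) \<le> node_mean (\<lambda>i. f (u i))"
  proof (rule node_mean_mono)
    fix i
    have "0 \<le> \<mu> / 2 * (norm (u i - ?c))\<^sup>2" using assms(2) by simp
    with strongly_convex_gradient[OF sc, of ?c "u i"]
    show "f ?c + (u i - ?c) \<bullet> G ?c \<le> f (u i)" by (simp add: inner_commute)
  qed
  then show ?thesis by (simp add: node_mean_add node_mean_inner node_mean_diff)
qed

section \<open>Decrease of the potential\<close>

text \<open>Here \<open>A\<close> stands for \<open>A_seq \<alpha> (k - 1)\<close> and \<open>E\<close>, \<open>E'\<close> for two consecutive estimating functions with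
minimizers \<open>y\<close> and \<open>y'\<close>; \<open>w\<close> is the point from which the cubic step \<open>h\<close> is taken and \<open>z\<close> the
optimum. After multiplication by \<open>A * (1 - \<alpha>)\<close>, strong convexity at the new point is applied twice:
towards \<open>z\<close> with weight \<open>\<alpha>\<close> and towards \<open>x\<close> with weight \<open>1 - \<alpha>\<close>. All function values cancel, and
there remains the pairing of the gradient with \<open>x' - (1 - \<alpha>) *\<^sub>R x - \<alpha> *\<^sub>R y'\<close>, which
\<open>cubic_step_progress\<close> bounds by means of the growth of \<open>E\<close> between \<open>y\<close> and \<open>y'\<close>. The last term of
the conclusion, the pairing of the gradient with the consensus error of \<open>w\<close>, is kept because it is
small only after averaging over the nodes.\<close>

lemma (in lipschitz_hessian) accelerated_step_potential:
  assumes sc: "strongly_convex \<mu> f" and pos: "0 < \<mu>" "0 < M" "0 < \<rho>" "0 \<le> D1" "0 \<le> D2" "0 < A"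
    and A: "A \<le> 1" and \<alpha>: "0 < \<alpha>" "\<alpha> \<le> 4 / 5"
    and E_sc: "strongly_convex (\<mu> / 2 + \<mu> * (1 / A - 1)) E"
    and E_min: "is_arg_min E (\<lambda>_. True) y"
    and E': "\<And>z. E' z = E z + \<alpha> / (A * (1 - \<alpha>))
      * (f (w + h) + g \<bullet> (z - (w + h)) + \<mu> / 2 * (norm (z - (w + h)))\<^sup>2)"
    and res: "norm (G (w + h) + \<zeta> *\<^sub>R h) \<le> \<zeta> * norm h / 3 + D1"
    and \<zeta>: "\<zeta> = 3 * D2 + 3 * M / 2 * norm h"
    and g: "norm (g - G (w + h)) \<le> Dg"
    and bounds: "norm h \<le> 2 * \<rho>" "norm (y' - y) \<le> 2 * \<rho>" "norm (z - y') \<le> \<rho>"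
    and D2_small: "2 * \<alpha>\<^sup>2 * D2 \<le> \<mu> / 20"
    and \<alpha>_small: "32 / 27 * M * \<alpha> ^ 3 \<le> \<mu> / (40 * \<rho>)"
  shows "E' z - E' y' + (f (w + h) - f z) / (A * (1 - \<alpha>))
    \<le> E z - E y + (f x - f z) / A
      + (\<alpha> * Dg * \<rho> + 2 * D1 * \<rho> * (1 + \<alpha>) - ((1 - \<alpha>) *\<^sub>R x + \<alpha> *\<^sub>R y - w) \<bullet> G (w + h))
        / (A * (1 - \<alpha>))"
proof -
  define x' A' a d where "x' = w + h" and "A' = A * (1 - \<alpha>)" and "a = G x'" and "d = y' - y"
  \<comment> \<open>What the growth of \<open>E\<close> provides; the bound \<open>norm d \<le> 2 * \<rho>\<close> makes it dominate a cubic term too.\<close>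
  define P where "P = (1 - \<alpha>) * \<mu> / 4 * (norm d)\<^sup>2"
  have A'pos: "0 < A'" using pos \<alpha> by (simp add: A'_def)
  have "\<mu> / 20 \<le> (1 - \<alpha>) * \<mu> / 4"
    using mult_right_mono[of "1 / 5" "1 - \<alpha>" \<mu>] pos \<alpha> by simp
  then have P: "\<mu> / 20 * (norm d)\<^sup>2 \<le> P" unfolding P_def by (rule mult_right_mono) simp
  have quadratic: "2 * \<alpha>\<^sup>2 * D2 * (norm d)\<^sup>2 \<le> P"
    using mult_right_mono[OF D2_small, of "(norm d)\<^sup>2"] P by simp
  have cubic: "32 / 27 * M * \<alpha> ^ 3 * norm d ^ 3 \<le> P"
  proof -
    have "32 / 27 * M * \<alpha> ^ 3 * norm d ^ 3 \<le> \<mu> / (40 * \<rho>) * norm d ^ 3"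
      by (intro mult_right_mono \<alpha>_small) simp
    also have "\<dots> = \<mu> / (40 * \<rho>) * (norm d)\<^sup>2 * norm d"
      by (simp add: power2_eq_square power3_eq_cube)
    also have "\<dots> \<le> \<mu> / (40 * \<rho>) * (norm d)\<^sup>2 * (2 * \<rho>)"
      using bounds(2) pos by (intro mult_left_mono) (auto simp: d_def)
    also have "\<dots> = \<mu> / 20 * (norm d)\<^sup>2" using pos by simp
    finally show ?thesis using P by simp
  qed
  have progress: "- D1 * (norm h + \<alpha> * norm d) \<le> - (a \<bullet> h) + \<alpha> * (a \<bullet> d) + P"
    using res unfolding a_def x'_def
    by (rule cubic_step_progress[OF _ \<zeta> pos(4,5,2) _ quadratic cubic]) (use \<alpha> in simp)
  have "D1 * (norm h + \<alpha> * norm d) \<le> D1 * (2 * \<rho> + \<alpha> * (2 * \<rho>))"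
    using bounds pos \<alpha> by (intro mult_left_mono add_mono) (auto simp: d_def)
  with progress have prog: "- (2 * D1 * \<rho> * (1 + \<alpha>)) \<le> - (a \<bullet> h) + \<alpha> * (a \<bullet> d) + P"
    by (simp add: algebra_simps)
  have growth: "P \<le> A' * (E y' - E y)"
  proof -
    have "\<mu> / (2 * A) \<le> \<mu> / 2 + \<mu> * (1 / A - 1)"
    proof -
      have "1 \<le> 1 / A" using A pos by simp
      then have "0 \<le> \<mu> / 2 * (1 / A - 1)" using pos by simp
      then show ?thesis by (simp add: algebra_simps)
    qed
    then have "\<mu> / (2 * A) / 2 * (norm d)\<^sup>2 \<le> (\<mu> / 2 + \<mu> * (1 / A - 1)) / 2 * (norm d)\<^sup>2"
      by (intro mult_right_mono divide_right_mono) auto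
    also have "\<dots> \<le> E y' - E y"
      using strongly_convex_minimizer_growth[OF E_sc E_min, of y'] unfolding d_def by linarith
    finally have "A' * (\<mu> / (2 * A) / 2 * (norm d)\<^sup>2) \<le> A' * (E y' - E y)"
      using A'pos by (intro mult_left_mono) auto
    moreover have "A' * (\<mu> / (2 * A) / 2 * (norm d)\<^sup>2) = P"
      using pos by (simp add: A'_def P_def)
    ultimately show ?thesis by simp
  qed
  have model: "g \<bullet> (z - y') + \<mu> / 2 * (norm (z - x'))\<^sup>2 - \<mu> / 2 * (norm (y' - x'))\<^sup>2
      \<le> f z - f x' + a \<bullet> (x' - y') + Dg * \<rho>"
  proof -
    have "(g - a) \<bullet> (z - y') \<le> norm (g - a) * norm (z - y')" by (rule norm_cauchy_schwarz)
    also have "\<dots> \<le> Dg * \<rho>"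
      using g bounds(3) order_trans[OF norm_ge_zero g]
      by (intro mult_mono) (auto simp: a_def x'_def)
    finally have "g \<bullet> (z - y') \<le> a \<bullet> (z - y') + Dg * \<rho>" by (simp add: inner_diff_left)
    moreover have "f x' + a \<bullet> (z - x') + \<mu> / 2 * (norm (z - x'))\<^sup>2 \<le> f z"
      unfolding a_def by (rule strongly_convex_gradient[OF sc])
    moreover have "a \<bullet> (z - y') = a \<bullet> (z - x') + a \<bullet> (x' - y')" by (simp add: inner_diff_right)
    moreover have "0 \<le> \<mu> / 2 * (norm (y' - x'))\<^sup>2" using pos by simp
    ultimately show ?thesis by linarith
  qed
  have diff: "A' * (E' z - E' y') = A' * (E z - E y') + \<alpha>
      * (g \<bullet> (z - y') + \<mu> / 2 * (norm (z - x'))\<^sup>2 - \<mu> / 2 * (norm (y' - x'))\<^sup>2)"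
  proof -
    have "E' z - E' y' = E z - E y' + \<alpha> / A'
      * (g \<bullet> (z - y') + \<mu> / 2 * (norm (z - x'))\<^sup>2 - \<mu> / 2 * (norm (y' - x'))\<^sup>2)"
      unfolding E' x'_def[symmetric] A'_def[symmetric]
      by (simp only: inner_diff_right) (simp add: algebra_simps)
    then show ?thesis using A'pos by (simp only: distrib_left) simp
  qed
  have fx: "(1 - \<alpha>) * (f x' + a \<bullet> (x - x')) \<le> (1 - \<alpha>) * f x"
  proof (rule mult_left_mono)
    have "0 \<le> \<mu> / 2 * (norm (x - x'))\<^sup>2" using pos by simp
    with strongly_convex_gradient[OF sc, of x' x] show "f x' + a \<bullet> (x - x') \<le> f x"
      by (simp add: a_def)
  qed (use \<alpha> in simp)
  have inner: "\<alpha> * (a \<bullet> (x' - y')) - (1 - \<alpha>) * (a \<bullet> (x - x'))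
      = a \<bullet> h - \<alpha> * (a \<bullet> d) - ((1 - \<alpha>) *\<^sub>R x + \<alpha> *\<^sub>R y - w) \<bullet> a"
    by (simp add: x'_def d_def inner_add_left inner_add_right inner_diff_left inner_diff_right
        inner_commute[of _ a] algebra_simps)
  have "A' * (E' z - E' y') + (f x' - f z)
      \<le> A' * (E z - E y) + (1 - \<alpha>) * (f x - f z)
        + (\<alpha> * Dg * \<rho> + 2 * D1 * \<rho> * (1 + \<alpha>) - ((1 - \<alpha>) *\<^sub>R x + \<alpha> *\<^sub>R y - w) \<bullet> a)"
  proof -
    have "A' * (E z - E y') = A' * (E z - E y) - A' * (E y' - E y)" by (simp add: algebra_simps)
    moreover have "\<alpha> * (g \<bullet> (z - y') + \<mu> / 2 * (norm (z - x'))\<^sup>2 - \<mu> / 2 * (norm (y' - x'))\<^sup>2)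
        \<le> \<alpha> * (f z - f x' + a \<bullet> (x' - y') + Dg * \<rho>)"
      using model \<alpha> by (intro mult_left_mono) auto
    ultimately show ?thesis
      using diff growth prog fx inner by (simp add: algebra_simps)
  qed
  then have "(A' * (E' z - E' y') + (f x' - f z)) / A'
      \<le> (A' * (E z - E y) + (1 - \<alpha>) * (f x - f z)
        + (\<alpha> * Dg * \<rho> + 2 * D1 * \<rho> * (1 + \<alpha>) - ((1 - \<alpha>) *\<^sub>R x + \<alpha> *\<^sub>R y - w) \<bullet> a)) / A'"
    using A'pos by (intro divide_right_mono) auto
  moreover have "(1 - \<alpha>) * (f x - f z) / A' = (f x - f z) / A"
    using \<alpha> by (simp add: A'_def)
  ultimately show ?thesis
    using A'pos unfolding x'_def[symmetric] A'_def[symmetric] a_def[symmetric]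
    by (simp add: add_divide_distrib)
qed

section \<open>Numerical consequences of the parameter choices\<close>

lemma step_size_bounds:
  assumes \<alpha>: "\<alpha> = min (4 / 5) (root 3 (3 * \<mu> * inverse \<rho> / (160 * M)))"
    and pos: "0 < \<mu>" "0 < \<rho>" "0 < M"
  shows "0 < \<alpha>" "\<alpha> \<le> 4 / 5" "32 / 27 * M * \<alpha> ^ 3 \<le> \<mu> / (40 * \<rho>)"
proof -
  let ?X = "3 * \<mu> * inverse \<rho> / (160 * M)"
  have X: "0 < ?X" using pos by simp
  show \<alpha>pos: "0 < \<alpha>" using X by (simp add: \<alpha>)
  show "\<alpha> \<le> 4 / 5" by (simp add: \<alpha>)
  have "\<alpha> ^ 3 \<le> (root 3 ?X) ^ 3" using \<alpha>pos by (intro power_mono) (auto simp: \<alpha>)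
  also have "\<dots> = ?X" using X by (intro real_root_pow_pos2) auto
  finally have "32 / 27 * M * \<alpha> ^ 3 \<le> 32 / 27 * M * ?X" using pos by (intro mult_left_mono) auto
  also have "\<dots> = \<mu> / (45 * \<rho>)" using pos by (simp add: field_simps)
  also have "\<dots> \<le> \<mu> / (40 * \<rho>)" using pos by (intro divide_left_mono) auto
  finally show "32 / 27 * M * \<alpha> ^ 3 \<le> \<mu> / (40 * \<rho>)" .
qed

lemma hessian_error_bound:
  fixes \<alpha> :: real
  assumes DH: "DH \<le> \<mu> / (60 * sqrt 5 * \<alpha>\<^sup>2)" and Dv: "Dv \<le> \<mu> / (120 * sqrt 5 * \<alpha>\<^sup>2 * M)"
    and pos: "0 < \<mu>" "0 < M" "0 < \<alpha>"
  shows "2 * \<alpha>\<^sup>2 * (DH + 2 * M * Dv) \<le> \<mu> / 20"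
proof -
  have "\<alpha>\<^sup>2 * DH \<le> \<alpha>\<^sup>2 * (\<mu> / (60 * sqrt 5 * \<alpha>\<^sup>2))"
    by (intro mult_left_mono DH) simp
  also have "\<dots> = \<mu> / (60 * sqrt 5)" using pos by simp
  finally have 1: "\<alpha>\<^sup>2 * DH \<le> \<mu> / (60 * sqrt 5)" .
  have "2 * M * \<alpha>\<^sup>2 * Dv \<le> 2 * M * \<alpha>\<^sup>2 * (\<mu> / (120 * sqrt 5 * \<alpha>\<^sup>2 * M))"
    using pos by (intro mult_left_mono Dv) simp
  also have "\<dots> = \<mu> / (60 * sqrt 5)" using pos by simp
  finally have 2: "2 * M * \<alpha>\<^sup>2 * Dv \<le> \<mu> / (60 * sqrt 5)" .
  have "2 \<le> sqrt 5" by (rule real_le_rsqrt) simp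
  then have "\<mu> / (60 * sqrt 5) \<le> \<mu> / (60 * 2)"
    using pos by (intro divide_left_mono mult_left_mono) auto
  with 1 2 have "\<alpha>\<^sup>2 * DH \<le> \<mu> / 120" "2 * M * \<alpha>\<^sup>2 * Dv \<le> \<mu> / 120" by simp_all
  moreover have "2 * \<alpha>\<^sup>2 * (DH + 2 * M * Dv) = 2 * (\<alpha>\<^sup>2 * DH) + 2 * (2 * M * \<alpha>\<^sup>2 * Dv)"
    by (simp add: algebra_simps)
  ultimately show ?thesis using pos by linarith
qed

text \<open>The left-hand side is the effect on a gradient of the disagreement between the new iterates of two
nodes: twice the spread of their base points, plus the perturbation of a cubic step of length at most
\<open>2 * \<rho>\<close> under errors \<open>2 * Dg\<close> and \<open>2 * DH\<close>.\<close>

lemma disagreement_bound: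
  fixes \<alpha> :: real
  assumes DH: "DH \<le> \<alpha> * \<mu> * \<epsilon> / (320 * M * \<rho>\<^sup>2)" and Dg: "Dg \<le> \<alpha> * \<mu> * \<epsilon> / (160 * M * \<rho>)"
    and Dv: "Dv \<le> \<alpha> * \<epsilon> / (320 * M * \<rho>)"
    and pos: "0 < \<mu>" "0 < M" "0 < \<rho>"
  shows "M * (2 * Dv + (2 * Dg + 4 * DH * \<rho>) / \<mu>) \<le> \<alpha> * \<epsilon> / (32 * \<rho>)"
proof -
  have "2 * M * Dv \<le> 2 * M * (\<alpha> * \<epsilon> / (320 * M * \<rho>))"
    using pos by (intro mult_left_mono Dv) simp
  also have "\<dots> = \<alpha> * \<epsilon> / \<rho> / 160" using pos by simp
  finally have 1: "2 * M * Dv \<le> \<alpha> * \<epsilon> / \<rho> / 160" .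
  have "2 * M / \<mu> * Dg \<le> 2 * M / \<mu> * (\<alpha> * \<mu> * \<epsilon> / (160 * M * \<rho>))"
    using pos by (intro mult_left_mono Dg) simp
  also have "\<dots> = \<alpha> * \<epsilon> / \<rho> / 80" using pos by simp
  finally have 2: "2 * M / \<mu> * Dg \<le> \<alpha> * \<epsilon> / \<rho> / 80" .
  have "4 * M * \<rho> / \<mu> * DH \<le> 4 * M * \<rho> / \<mu> * (\<alpha> * \<mu> * \<epsilon> / (320 * M * \<rho>\<^sup>2))"
    using pos by (intro mult_left_mono DH) simp
  also have "\<dots> = \<alpha> * \<epsilon> / \<rho> / 80" using pos by (simp add: power2_eq_square)
  finally have 3: "4 * M * \<rho> / \<mu> * DH \<le> \<alpha> * \<epsilon> / \<rho> / 80" .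
  have "M * (2 * Dv + (2 * Dg + 4 * DH * \<rho>) / \<mu>)
      = 2 * M * Dv + 2 * M / \<mu> * Dg + 4 * M * \<rho> / \<mu> * DH"
    by (simp add: distrib_left add_divide_distrib mult_ac)
  also have "\<dots> \<le> \<alpha> * \<epsilon> / \<rho> / 160 + \<alpha> * \<epsilon> / \<rho> / 80 + \<alpha> * \<epsilon> / \<rho> / 80"
    by (intro add_mono 1 2 3)
  also have "\<dots> = \<alpha> * \<epsilon> / \<rho> / 32" by simp
  finally show ?thesis by (simp add: mult.commute)
qed

text \<open>The per-step errors, in order: the gradient in the estimating function against \<open>xstar - y\<close>; the
gradient in the cubic model against \<open>h\<close> and \<open>\<alpha> *\<^sub>R d\<close>; and the consensus error of the base points
against the gradient, split into its disagreement and its common part. The factor \<open>\<alpha>\<close> on the right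
is what remains summable: \<open>\<alpha> / A_k\<close> telescopes.\<close>

lemma step_error_budget:
  fixes \<alpha> :: real
  assumes \<alpha>: "0 < \<alpha>" "\<alpha> \<le> 1" and pos: "0 < \<rho>" "0 < \<epsilon>"
    and Dx: "Dx \<le> \<epsilon> / (8 * \<rho>)" and dis: "M * r \<le> \<alpha> * \<epsilon> / (32 * \<rho>)"
    and D1: "D1 \<le> \<alpha> * \<epsilon> / (80 * \<rho>)" and Dv: "M * Dv \<le> \<alpha> * \<epsilon> / (320 * \<rho>)"
  shows "\<alpha> * (Dx + M * r) * \<rho> + 2 * D1 * \<rho> * (1 + \<alpha>) + (2 * \<rho> * (M * r) + \<rho> * (M * Dv))
    \<le> \<alpha> * \<epsilon> / 2"
proof -
  have r: "\<rho> * Dx \<le> \<epsilon> / 8" "\<rho> * (M * r) \<le> \<alpha> * \<epsilon> / 32" "\<rho> * D1 \<le> \<alpha> * \<epsilon> / 80"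
    "\<rho> * (M * Dv) \<le> \<alpha> * \<epsilon> / 320"
    using mult_left_mono[OF Dx, of \<rho>] mult_left_mono[OF dis, of \<rho>] mult_left_mono[OF D1, of \<rho>]
      mult_left_mono[OF Dv, of \<rho>] pos by simp_all
  have \<epsilon>\<alpha>: "0 < \<alpha> * \<epsilon>" "\<alpha> * (\<alpha> * \<epsilon>) \<le> \<alpha> * \<epsilon>" using \<alpha> pos by (simp_all add: mult_left_le_one_le)
  have "\<alpha> * (\<rho> * Dx) \<le> \<alpha> * (\<epsilon> / 8)" "\<alpha> * (\<rho> * (M * r)) \<le> \<alpha> * (\<alpha> * \<epsilon> / 32)"
    "\<alpha> * (\<rho> * D1) \<le> \<alpha> * (\<alpha> * \<epsilon> / 80)"
    using \<alpha> by (intro mult_left_mono r; simp)+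
  moreover have "\<alpha> * (Dx + M * r) * \<rho> + 2 * D1 * \<rho> * (1 + \<alpha>) + (2 * \<rho> * (M * r) + \<rho> * (M * Dv))
    = \<alpha> * (\<rho> * Dx) + \<alpha> * (\<rho> * (M * r)) + 2 * (\<rho> * D1) + 2 * (\<alpha> * (\<rho> * D1))
      + 2 * (\<rho> * (M * r)) + \<rho> * (M * Dv)"
    by (simp add: algebra_simps)
  ultimately show ?thesis using r \<epsilon>\<alpha> by simp
qed

lemma geometric_decay_bound:
  fixes \<alpha> c :: real
  assumes \<alpha>: "0 < \<alpha>" "\<alpha> < 1" and "0 < c" "0 < \<epsilon>"
    and N: "int N \<ge> \<lceil>ln (2 * c / \<epsilon>) / ln (1 / (1 - \<alpha>))\<rceil>"
  shows "(1 - \<alpha>) ^ N * c \<le> \<epsilon> / 2"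
proof -
  have q: "0 < 2 * c / \<epsilon>" using assms by simp
  have l: "0 < ln (1 / (1 - \<alpha>))" using \<alpha> by simp
  have "ln (2 * c / \<epsilon>) / ln (1 / (1 - \<alpha>)) \<le> real N"
    using N by (simp add: ceiling_le_iff)
  then have "ln (2 * c / \<epsilon>) \<le> real N * ln (1 / (1 - \<alpha>))" using l by (simp add: pos_divide_le_eq)
  also have "\<dots> = ln ((1 / (1 - \<alpha>)) ^ N)" by (rule ln_realpow[symmetric])
  finally have "2 * c / \<epsilon> \<le> (1 / (1 - \<alpha>)) ^ N" using q \<alpha> by simp
  also have "\<dots> = 1 / (1 - \<alpha>) ^ N" by (simp add: power_one_over)
  finally show ?thesis using \<alpha> assms by (simp add: field_simps)
qed

section \<open>Complexity of the accelerated decentralized method\<close>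

theorem theorem3:
  fixes fs :: "'m::finite \<Rightarrow> real^'d \<Rightarrow> real"
    and f :: "real^'d \<Rightarrow> real"
    and \<mu> L1 L2 :: "'m \<Rightarrow> real"
    and \<mu>bar \<mu>hat L1bar L2bar :: real
    and xstar x0 :: "real^'d"
    and W :: "nat \<Rightarrow> real^'m^'m"
    and sv sg sH sx Tv Tg TH Tx :: "nat \<Rightarrow> nat"
    and N :: nat
    and L :: real
    and \<delta>2 \<kappa>2 \<kappa>3 \<alpha>s :: "nat \<Rightarrow> real"
    and x y v vh gv gx :: "nat \<Rightarrow> 'm \<Rightarrow> real^'d"
    and Hv :: "nat \<Rightarrow> 'm \<Rightarrow> real^'d^'d"
    and Dvs Dgvs DHs Dgxs D1 D2 :: "nat \<Rightarrow> real"
    and Dv Dgv DH Dgx R Rbar \<epsilon> \<alpha> C :: real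
  assumes f_def: "f = (\<lambda>z. node_mean (\<lambda>i. fs i z))"
    and mu_pos: "\<And>i. \<mu> i > 0"
    and strong_convexity: "\<And>i. strongly_convex (\<mu> i) (fs i)"
    and smooth: "\<And>i. twice_differentiable (fs i)"
    and grad_lipschitz: "\<And>i. (L1 i)-lipschitz_on UNIV (gradient (fs i))"
    and hess_lipschitz:
      "\<And>i z w. op_norm (hessian (fs i) z - hessian (fs i) w) \<le> L2 i * norm (z - w)"
    and mubar_def: "\<mu>bar = node_mean \<mu>"
    and muhat_def: "\<mu>hat = Min (range \<mu>)"
    and L1bar_def: "L1bar = node_mean L1"
    and L2bar_def: "L2bar = node_mean L2"
    and L1bar_pos: "L1bar > 0"
    and L2bar_pos: "L2bar > 0"
    and xstar_min: "is_arg_min f (\<lambda>_. True) xstar"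
    and mixing: "\<And>k. k \<ge> 1 \<Longrightarrow> mixing_matrix (W k)"
    \<comment> \<open>the run of the algorithm\<close>
    and N_ge_1: "N \<ge> 1"
    and x_init: "\<And>i. x 0 i = x0"
    and v_init: "\<And>i. v 0 i = x 0 i"
    and v_step: "\<And>k i. 1 \<le> k \<Longrightarrow> k \<le> N \<Longrightarrow>
      v k i = (1 - \<alpha>s k) *\<^sub>R x k i + \<alpha>s k *\<^sub>R y k i"
    and vh_step: "\<And>k i. k \<le> N \<Longrightarrow> vh k i = consensus W (sv k) (Tv k) (v k) i"
    and gv_step: "\<And>k i. k \<le> N \<Longrightarrow>
      gv k i = consensus W (sg k) (Tg k) (\<lambda>j. gradient (fs j) (vh k j)) i"
    and Hv_step: "\<And>k i. k \<le> N \<Longrightarrow>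
      Hv k i = consensus_matrix W (sH k) (TH k) (\<lambda>j. hessian (fs j) (vh k j)) i"
    and x_step: "\<And>k i. k \<le> N \<Longrightarrow>
      is_arg_min (cubic_model L (\<delta>2 k) (vh k i) (gv k i) (Hv k i)) (\<lambda>_. True) (x (k + 1) i)"
    and gx_step: "\<And>k i. k \<le> N \<Longrightarrow>
      gx (k + 1) i = consensus W (sx k) (Tx k) (\<lambda>j. gradient (fs j) (x (k + 1) j)) i"
    and y_step: "\<And>k i. k \<le> N \<Longrightarrow>
      is_arg_min (est_fun f \<kappa>2 \<kappa>3 \<alpha>s \<mu>bar (vh 0 i) (\<lambda>l. x l i) (\<lambda>l. gx l i) (k + 1))
        (\<lambda>_. True) (y (k + 1) i)"
    \<comment> \<open>consensus error levels\<close>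
    and Dv_level: "\<And>k i. k \<le> N \<Longrightarrow> norm (vh k i - node_mean (v k)) \<le> Dvs k"
    and Dgv_level: "\<And>k i. k \<le> N \<Longrightarrow>
      norm (gv k i - node_mean (\<lambda>j. gradient (fs j) (vh k j))) \<le> Dgvs k"
    and DH_level: "\<And>k i. k \<le> N \<Longrightarrow>
      op_norm (Hv k i - node_mean (\<lambda>j. hessian (fs j) (vh k j))) \<le> DHs k"
    and Dgx_level: "\<And>k i. k \<le> N \<Longrightarrow>
      norm (gx (k + 1) i - node_mean (\<lambda>j. gradient (fs j) (x (k + 1) j))) \<le> Dgxs (k + 1)"
    and D1_def: "\<And>k. D1 k = Dgvs k + 2 * L1bar * Dvs k"
    and D2_def: "\<And>k. D2 k = DHs k + 2 * L2bar * Dvs k"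
    \<comment> \<open>hypotheses on the run and choice of the parameters\<close>
    and R_def: "R = norm (x0 - xstar)"
    and R_pos: "R > 0"
    and Rbar_pos: "Rbar > 0"
    and xy_bounded: "\<And>k i. 1 \<le> k \<Longrightarrow> k \<le> N + 1 \<Longrightarrow>
      norm (x k i - xstar) \<le> Rbar \<and> norm (y k i - xstar) \<le> Rbar"
    and v_bounded: "\<And>k i. 1 \<le> k \<Longrightarrow> k \<le> N \<Longrightarrow>
      norm (vh k i - xstar) \<le> Rbar \<and> norm (v k i - xstar) \<le> Rbar"
    and eps_pos: "\<epsilon> > 0"
    and alpha_def: "\<alpha> = min (4 / 5) (root 3 (3 * \<mu>bar * inverse Rbar / (160 * L2bar)))"
    and alphas: "\<And>k. 1 \<le> k \<Longrightarrow> k \<le> N \<Longrightarrow> \<alpha>s k = \<alpha>"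
    and DHs_eq: "\<And>k. k \<le> N \<Longrightarrow> DHs k = DH"
    and DH_le: "DH \<le> min (\<mu>bar / (60 * sqrt 5 * \<alpha>\<^sup>2)) (\<alpha> * \<mu>hat * \<epsilon> / (320 * L1bar * Rbar\<^sup>2))"
    and Dgvs_eq: "\<And>k. k \<le> N \<Longrightarrow> Dgvs k = Dgv"
    and Dgv_le: "Dgv \<le> min (\<alpha> * \<mu>hat * \<epsilon> / (160 * L1bar * Rbar)) (\<alpha> * \<epsilon> / (160 * Rbar))"
    and Dvs_eq: "\<And>k. k \<le> N \<Longrightarrow> Dvs k = Dv"
    and Dv_le: "Dv \<le> min (\<mu>bar / (120 * sqrt 5 * \<alpha>\<^sup>2 * L2bar)) (\<alpha> * \<epsilon> / (320 * L1bar * Rbar))"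
    and Dgxs_eq: "\<And>k. k \<le> N \<Longrightarrow> Dgxs (k + 1) = Dgx"
    and Dgx_le: "Dgx \<le> \<epsilon> / (8 * Rbar)"
    and L_eq: "L = 3 * L2bar"
    and delta2_eq: "\<And>k. k \<le> N \<Longrightarrow> \<delta>2 k = 3 * D2 k"
    and kappa2_eq: "\<And>k. k \<le> N \<Longrightarrow> \<kappa>2 k = \<mu>bar / 2"
    and kappa3_eq: "\<And>k. k \<le> N \<Longrightarrow> \<kappa>3 k = 3 / 2 * \<mu>bar * inverse Rbar"
    and C_def: "C = 4 * D1 0 / (\<mu>bar * R) + 4 * D1 0 * Rbar / (\<mu>bar * R\<^sup>2) + 4 * D2 0 / \<mu>bar + 1 / 2
      + (8 * L2bar + 3 * \<mu>bar * inverse Rbar) / (6 * \<mu>bar) * R"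
    and N_large: "int N \<ge>
      \<lceil>ln (2 * C * (f (node_mean (x 0)) - f xstar) / \<epsilon>) / ln (1 / (1 - \<alpha>))\<rceil>"
  shows "f (node_mean (x (N + 1))) - f xstar \<le> \<epsilon>"
proof -
  define G where "G z = node_mean (\<lambda>i. gradient (fs i) z)" for z
  define H where "H z = node_mean (\<lambda>i. hessian (fs i) z)" for z
  interpret node: lipschitz_hessian "fs i" "gradient (fs i)" "hessian (fs i)" "L2 i" for i
    using smooth hess_lipschitz by (rule lipschitz_hessian_gradient_hessian)
  interpret lipschitz_hessian f G H L2bar
    using lipschitz_hessian_node_mean[where F = fs, OF node.lipschitz_hessian_axioms]
    by (simp add: f_def L2bar_def G_def [abs_def] H_def [abs_def])

  have mubar: "0 < \<mu>bar" unfolding mubar_def by (rule node_mean_pos) (rule mu_pos)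
  have muhat: "0 < \<mu>hat" and muhat_le: "\<mu>hat \<le> \<mu> i" for i
    using mu_pos by (auto simp: muhat_def)
  have sc: "strongly_convex \<mu>bar f"
    unfolding f_def mubar_def by (rule strongly_convex_node_mean) (rule strong_convexity)
  have L1: "0 \<le> L1 i" and node_grad_lip: "norm (gradient (fs i) a - gradient (fs i) b) \<le> L1 i * norm (a - b)"
    for i a b
    using grad_lipschitz[of i] by (auto simp: lipschitz_on_def dist_norm)
  have node_hess_lip: "norm (hessian (fs i) a *v h - hessian (fs i) b *v h) \<le> L2 i * norm h * norm (a - b)"
    for i a b h
    using node.hess_lip[of i a b h] by (simp add: matrix_vector_mult_diff_rdistrib mult_ac)
  have G_lip: "norm (G a - G b) \<le> L1bar * norm (a - b)" for a b
    unfolding G_def L1bar_def by (rule norm_node_mean_diff_le[OF node_grad_lip L1]) simp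

  have opt: "f xstar \<le> f z" for z using xstar_min by (auto simp: is_arg_min_def not_less)
  have G_opt: "G xstar = 0"
  proof -
    have "(\<lambda>h. G xstar \<bullet> h) = (\<lambda>h. 0)"
      by (rule differential_zero_maxmin[OF UNIV_I open_UNIV grad]) (use opt in blast)
    then have "G xstar \<bullet> G xstar = 0" by (rule fun_cong)
    then show ?thesis by simp
  qed
  have G_norm: "norm (G z) \<le> L1bar * norm (z - xstar)" for z
    using G_lip[of z xstar] by (simp add: G_opt)

  have alpha: "0 < \<alpha>" "\<alpha> \<le> 4 / 5" "32 / 27 * L2bar * \<alpha> ^ 3 \<le> \<mu>bar / (40 * Rbar)"
    using step_size_bounds[OF alpha_def mubar Rbar_pos L2bar_pos] by blast+

  define d1 where "d1 = Dgv + 2 * L1bar * Dv"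
  define d2 where "d2 = DH + 2 * L2bar * Dv"
  have Dv: "norm (vh k i - node_mean (v k)) \<le> Dv"
    and Dgv: "norm (gv k i - node_mean (\<lambda>j. gradient (fs j) (vh k j))) \<le> Dgv"
    and DH: "op_norm (Hv k i - node_mean (\<lambda>j. hessian (fs j) (vh k j))) \<le> DH"
    and Dgx: "norm (gx (k + 1) i - node_mean (\<lambda>j. gradient (fs j) (x (k + 1) j))) \<le> Dgx"
    if "k \<le> N" for k i
    using Dv_level[OF that, of i] Dgv_level[OF that, of i] DH_level[OF that, of i]
      Dgx_level[OF that, of i]
    unfolding Dvs_eq[OF that] Dgvs_eq[OF that] DHs_eq[OF that] Dgxs_eq[OF that] by blast+
  have Dv0: "0 \<le> Dv" and Dgv0: "0 \<le> Dgv"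
    using order_trans[OF norm_ge_zero Dv[of 0]] order_trans[OF norm_ge_zero Dgv[of 0]] by blast+
  have DH_mult: "norm ((Hv k i - node_mean (\<lambda>j. hessian (fs j) (vh k j))) *v h) \<le> DH * norm h"
    if "k \<le> N" for k i h
    by (rule order_trans[OF norm_matrix_vector_le_op_norm]) (intro mult_right_mono DH that norm_ge_zero)
  have DH0: "0 \<le> DH"
    using onorm_pos_le[OF matrix_vector_mul_bounded_linear] DH[of 0]
    unfolding op_norm_def by (meson order_trans zero_le)
  have d0: "0 \<le> d1" "0 \<le> d2"
    using Dv0 Dgv0 DH0 L1bar_pos L2bar_pos by (simp_all add: d1_def d2_def)
  have D_eq: "D1 k = d1" "D2 k = d2" if "k \<le> N" for k
    using that by (simp_all add: D1_def D2_def d1_def d2_def Dgvs_eq Dvs_eq DHs_eq)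

  have vh_near: "norm (vh k j - vh k i) \<le> 2 * Dv" if "k \<le> N" for k i j
    using norm_triangle_ineq4[of "vh k j - node_mean (v k)" "vh k i - node_mean (v k)"]
      Dv[OF that, of i] Dv[OF that, of j] by simp
  have gv_err: "norm (gv k i - G (vh k i)) \<le> d1" if k: "k \<le> N" for k i
  proof -
    have "norm (node_mean (\<lambda>j. gradient (fs j) (vh k j)) - G (vh k i)) \<le> L1bar * (2 * Dv)"
      unfolding G_def L1bar_def
      by (rule norm_node_mean_diff_le[OF node_grad_lip L1 vh_near[OF k]])
    with Dgv[OF k, of i] show ?thesis
      using norm_triangle_ineq[of "gv k i - node_mean (\<lambda>j. gradient (fs j) (vh k j))"
          "node_mean (\<lambda>j. gradient (fs j) (vh k j)) - G (vh k i)"]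
      by (simp add: d1_def)
  qed
  have Hv_err: "norm ((Hv k i - H (vh k i)) *v h) \<le> d2 * norm h" if k: "k \<le> N" for k i h
  proof -
    let ?m = "node_mean (\<lambda>j. hessian (fs j) (vh k j))"
    have "norm (node_mean (\<lambda>j. hessian (fs j) (vh k j) *v h)
        - node_mean (\<lambda>j. hessian (fs j) (vh k i) *v h))
        \<le> node_mean (\<lambda>j. L2 j * norm h) * (2 * Dv)"
      using node.lipschitz_const_nonneg
      by (intro norm_node_mean_diff_le[OF node_hess_lip _ vh_near[OF k]]) simp
    then have "norm ((?m - H (vh k i)) *v h) \<le> L2bar * norm h * (2 * Dv)"
      by (simp only: node_mean_matrix_vector node_mean_mult_right H_def L2bar_def
          matrix_vector_mult_diff_rdistrib)
    moreover have "(Hv k i - H (vh k i)) *v h = (Hv k i - ?m) *v h + (?m - H (vh k i)) *v h"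
      by (simp add: matrix_vector_mult_diff_rdistrib)
    ultimately show ?thesis
      using norm_triangle_ineq[of "(Hv k i - ?m) *v h" "(?m - H (vh k i)) *v h"] DH_mult[OF k, of i h]
      by (simp add: d2_def algebra_simps)
  qed
  have Hv_sym: "(Hv k i *v a) \<bullet> b = a \<bullet> (Hv k i *v b)" if "k \<le> N" for k i a b
    unfolding Hv_step[OF that] by (rule consensus_matrix_symmetric) (rule node.hess_symmetric)
  \<comment> \<open>Mixing only preserves the worst strong convexity modulus, hence the minimum rather than the mean.\<close>
  have Hv_ge: "\<mu>hat * (norm a)\<^sup>2 \<le> (Hv k i *v a) \<bullet> a" if "k \<le> N" for k i a
    unfolding Hv_step[OF that]
  proof (rule consensus_matrix_ge[OF mixing])
    fix j
    have "\<mu>hat * (norm a)\<^sup>2 \<le> \<mu> j * (norm a)\<^sup>2" by (intro mult_right_mono muhat_le) simp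
    also have "\<dots> \<le> (hessian (fs j) (vh k j) *v a) \<bullet> a"
      by (rule node.strongly_convex_hessian) (rule strong_convexity)
    finally show "\<mu>hat * (norm a)\<^sup>2 \<le> (hessian (fs j) (vh k j) *v a) \<bullet> a" .
  qed

  define h where "h k i = x (k + 1) i - vh k i" for k i
  have x_eq: "x (k + 1) i = vh k i + h k i" for k i by (simp add: h_def)
  have x_min: "is_arg_min (cubic_model (3 * L2bar) (3 * d2) (vh k i) (gv k i) (Hv k i))
      (\<lambda>_. True) (x (k + 1) i)" if "k \<le> N" for k i
    using x_step[OF that, of i] D_eq(2)[OF that] by (simp add: L_eq delta2_eq[OF that])
  have stat: "gv k i + Hv k i *v h k i + (3 * d2 + 3 * L2bar / 2 * norm (h k i)) *\<^sub>R h k i = 0"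
    if k: "k \<le> N" for k i
    using cubic_model_minimizer_stationary[OF _ Hv_sym[OF k]] x_min[OF k, of i]
    unfolding x_eq by blast
  have res: "norm (G (vh k i + h k i) + (3 * d2 + 3 * L2bar / 2 * norm (h k i)) *\<^sub>R h k i)
      \<le> (3 * d2 + 3 * L2bar / 2 * norm (h k i)) * norm (h k i) / 3 + d1" if k: "k \<le> N" for k i
    by (rule inexact_cubic_step_residual[OF stat[OF k] gv_err[OF k] Hv_err[OF k] refl])
  have h_le: "norm (h k i) \<le> 2 * Rbar" if "1 \<le> k" "k \<le> N" for k i
    using norm_triangle_ineq4[of "x (k + 1) i - xstar" "vh k i - xstar"]
      xy_bounded[of "k + 1" i] v_bounded[OF that, of i] that by (simp add: h_def)

  define r where "r = 2 * Dv + (2 * Dgv + 4 * DH * Rbar) / \<mu>hat"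
  have x_near: "norm (x (k + 1) j - x (k + 1) i) \<le> r" if k: "1 \<le> k" "k \<le> N" for k i j
  proof -
    have g2: "norm (gv k j - gv k i) \<le> 2 * Dgv"
      using norm_triangle_ineq4[of "gv k j - node_mean (\<lambda>j. gradient (fs j) (vh k j))"
          "gv k i - node_mean (\<lambda>j. gradient (fs j) (vh k j))"]
        Dgv[OF k(2), of i] Dgv[OF k(2), of j] by simp
    let ?m = "node_mean (\<lambda>j. hessian (fs j) (vh k j))"
    have "(Hv k j - Hv k i) *v h k i = (Hv k j - ?m) *v h k i - (Hv k i - ?m) *v h k i"
      by (simp add: matrix_vector_mult_diff_rdistrib)
    then have "norm ((Hv k j - Hv k i) *v h k i) \<le> 2 * DH * norm (h k i)"
      using norm_triangle_ineq4[of "(Hv k j - ?m) *v h k i" "(Hv k i - ?m) *v h k i"]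
        DH_mult[OF k(2), of i "h k i"] DH_mult[OF k(2), of j "h k i"] by simp
    also have "\<dots> \<le> 2 * DH * (2 * Rbar)" using DH0 h_le[OF k] by (intro mult_left_mono) auto
    finally have H2: "norm ((Hv k j - Hv k i) *v h k i) \<le> 4 * DH * Rbar" by simp
    have "\<mu>hat * norm (h k j - h k i) \<le> norm (gv k j - gv k i) + norm ((Hv k j - Hv k i) *v h k i)"
      by (rule cubic_stationary_perturbation[OF stat[OF k(2)] stat[OF k(2)] Hv_ge[OF k(2)]])
        (use d0 L2bar_pos in auto)
    with g2 H2 have "\<mu>hat * norm (h k j - h k i) \<le> 2 * Dgv + 4 * DH * Rbar" by linarith
    then have "norm (h k j - h k i) \<le> (2 * Dgv + 4 * DH * Rbar) / \<mu>hat"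
      using muhat by (simp add: pos_le_divide_eq mult.commute)
    moreover have "x (k + 1) j - x (k + 1) i = (vh k j - vh k i) + (h k j - h k i)"
      by (simp add: h_def)
    ultimately show ?thesis
      using norm_triangle_ineq[of "vh k j - vh k i" "h k j - h k i"] vh_near[OF k(2), of j i]
      by (simp add: r_def)
  qed
  have gx_err: "norm (gx (k + 1) i - G (x (k + 1) i)) \<le> Dgx + L1bar * r"
    if k: "1 \<le> k" "k \<le> N" for k i
  proof -
    let ?m = "node_mean (\<lambda>j. gradient (fs j) (x (k + 1) j))"
    have "norm (?m - G (x (k + 1) i)) \<le> L1bar * r"
      unfolding G_def L1bar_def
      by (rule norm_node_mean_diff_le[OF node_grad_lip L1 x_near[OF k]])
    with Dgx[OF k(2), of i] show ?thesis
      using norm_triangle_ineq[of "gx (k + 1) i - ?m" "?m - G (x (k + 1) i)"] by simp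
  qed

  have Dv_L1: "L1bar * Dv \<le> \<alpha> * \<epsilon> / (320 * Rbar)"
  proof -
    have "L1bar * Dv \<le> L1bar * (\<alpha> * \<epsilon> / (320 * L1bar * Rbar))"
      using L1bar_pos Dv_le by (intro mult_left_mono) auto
    then show ?thesis using L1bar_pos by simp
  qed
  have d1_le: "d1 \<le> \<alpha> * \<epsilon> / (80 * Rbar)"
    using Dgv_le Dv_L1 by (simp add: d1_def)
  have d2_small: "2 * \<alpha>\<^sup>2 * d2 \<le> \<mu>bar / 20"
    unfolding d2_def using DH_le Dv_le mubar L2bar_pos alpha
    by (intro hessian_error_bound) auto
  have r_L1: "L1bar * r \<le> \<alpha> * \<epsilon> / (32 * Rbar)"
    unfolding r_def using DH_le Dgv_le Dv_le muhat L1bar_pos Rbar_pos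
    by (intro disagreement_bound) auto
  have budget: "\<alpha> * (Dgx + L1bar * r) * Rbar + 2 * d1 * Rbar * (1 + \<alpha>)
      + (2 * Rbar * (L1bar * r) + Rbar * (L1bar * Dv)) \<le> \<alpha> * \<epsilon> / 2"
    using alpha Rbar_pos eps_pos Dgx_le r_L1 d1_le Dv_L1 by (intro step_error_budget) auto

  have A: "A_seq \<alpha>s k = (1 - \<alpha>) ^ k" if "k \<le> N" for k
    using that alphas by (simp add: A_seq_def)
  \<comment> \<open>Shifted by one: \<open>E k\<close> is built from the first \<open>k + 1\<close> steps and minimized by \<open>y (k + 1)\<close>, and its
    weights sum to \<open>1 / (1 - \<alpha>) ^ k - 1\<close>.\<close>
  define E where "E k i = est_fun f \<kappa>2 \<kappa>3 \<alpha>s \<mu>bar (vh 0 i) (\<lambda>l. x l i) (\<lambda>l. gx l i) (k + 1)"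
    for k i
  have E_min: "is_arg_min (E k i) (\<lambda>_. True) (y (k + 1) i)" if "k \<le> N" for k i
    unfolding E_def by (rule y_step[OF that])
  have E_sc: "strongly_convex (\<mu>bar / 2 + \<mu>bar * (1 / (1 - \<alpha>) ^ k - 1)) (E k i)" if k: "k \<le> N" for k i
  proof -
    have "strongly_convex (\<mu>bar / 2 + \<mu>bar * (1 / A_seq \<alpha>s k - 1)) (E k i)"
      unfolding E_def Suc_eq_plus1[symmetric]
      using k alpha alphas kappa2_eq kappa3_eq mubar Rbar_pos
      by (intro est_fun_strongly_convex[where b = "3 / 2 * \<mu>bar * inverse Rbar"]) auto
    then show ?thesis by (simp add: A[OF k])
  qed
  have E_Suc: "E (Suc k) i z = E k i z + \<alpha> / ((1 - \<alpha>) ^ k * (1 - \<alpha>))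
      * (f (vh (Suc k) i + h (Suc k) i) + gx (Suc k + 1) i \<bullet> (z - (vh (Suc k) i + h (Suc k) i))
        + \<mu>bar / 2 * (norm (z - (vh (Suc k) i + h (Suc k) i)))\<^sup>2)" if k: "Suc k \<le> N" for k i z
    unfolding E_def Suc_eq_plus1[symmetric] x_eq[symmetric]
    using k by (subst est_fun.simps(2)) (simp add: kappa2_eq kappa3_eq alphas A mult.commute)

  \<comment> \<open>The potential: both summands are nonnegative, and the second is the weighted suboptimality.\<close>
  define V where "V k = node_mean (\<lambda>i. E k i xstar - E k i (y (k + 1) i)
      + (f (x (k + 1) i) - f xstar) / (1 - \<alpha>) ^ k)" for k
  have V_step: "V (Suc k) \<le> V k + \<epsilon> / 2 * (1 / (1 - \<alpha>) ^ Suc k - 1 / (1 - \<alpha>) ^ k)"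
    if k: "Suc k \<le> N" for k
  proof -
    let ?A = "(1 - \<alpha>) ^ k" and ?A' = "(1 - \<alpha>) ^ k * (1 - \<alpha>)"
    let ?u = "\<lambda>i. v (Suc k) i - vh (Suc k) i" and ?G = "\<lambda>i. G (x (Suc k + 1) i)"
    let ?e = "\<alpha> * (Dgx + L1bar * r) * Rbar + 2 * d1 * Rbar * (1 + \<alpha>)"
    have k1: "1 \<le> Suc k" and kN: "k \<le> N" using k by simp_all
    have Apos: "0 < ?A" "0 < ?A'" using alpha by simp_all
    have node_step: "E (Suc k) i xstar - E (Suc k) i (y (Suc k + 1) i)
        + (f (x (Suc k + 1) i) - f xstar) / ?A'
      \<le> E k i xstar - E k i (y (k + 1) i) + (f (x (k + 1) i) - f xstar) / ?A
        + (?e - ?u i \<bullet> ?G i) / ?A'" for i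
    proof -
      have "norm (y (Suc k + 1) i - y (k + 1) i) \<le> 2 * Rbar"
        using norm_triangle_ineq4[of "y (Suc k + 1) i - xstar" "y (k + 1) i - xstar"]
          xy_bounded[of "Suc k + 1" i] xy_bounded[of "k + 1" i] k by simp
      moreover have "norm (xstar - y (Suc k + 1) i) \<le> Rbar"
        using xy_bounded[of "Suc k + 1" i] k by (simp add: norm_minus_commute)
      moreover have "v (Suc k) i = (1 - \<alpha>) *\<^sub>R x (k + 1) i + \<alpha> *\<^sub>R y (k + 1) i"
        using v_step[OF k1 k, of i] alphas[OF k1 k] by simp
      moreover have "?A \<le> 1" using alpha by (intro power_le_one) auto
      ultimately show ?thesis
        using accelerated_step_potential[OF sc mubar L2bar_pos Rbar_pos d0 Apos(1) _ alpha(1,2)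
            E_sc[OF kN, of i] E_min[OF kN, of i] E_Suc[OF k, of i] res[OF k, of i] refl
            gx_err[OF k1 k, of i, unfolded x_eq] h_le[OF k1 k, of i] _ _ d2_small alpha(3),
            where x = "x (k + 1) i" and z = xstar and y' = "y (Suc k + 1) i"]
        unfolding x_eq[symmetric] by simp
    qed
    have cross: "- node_mean (\<lambda>i. ?u i \<bullet> ?G i) \<le> 2 * Rbar * (L1bar * r) + Rbar * (L1bar * Dv)"
    proof -
      \<comment> \<open>Any fixed node: its gradient serves as the common one, which meets only the averaged error.\<close>
      obtain i0 :: 'm where True by blast
      have x0_bd: "norm (x (Suc k + 1) i0 - xstar) \<le> Rbar" using xy_bounded[of "Suc k + 1" i0] k by simp
      have "- (?u i \<bullet> ?G i) \<le> 2 * Rbar * (L1bar * r) - ?u i \<bullet> ?G i0" for i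
      proof -
        have "norm (?u i) \<le> 2 * Rbar"
          using norm_triangle_ineq4[of "v (Suc k) i - xstar" "vh (Suc k) i - xstar"]
            v_bounded[OF k1 k, of i] by simp
        moreover have "norm (?G i0 - ?G i) \<le> L1bar * r"
          by (rule order_trans[OF G_lip])
            (use L1bar_pos x_near[OF k1 k] in \<open>intro mult_left_mono, auto\<close>)
        ultimately have "norm (?u i) * norm (?G i0 - ?G i) \<le> 2 * Rbar * (L1bar * r)"
          using Rbar_pos by (intro mult_mono) auto
        with norm_cauchy_schwarz[of "?u i" "?G i0 - ?G i"]
        show ?thesis by (simp add: inner_diff_right)
      qed
      then have "node_mean (\<lambda>i. - (?u i \<bullet> ?G i))
          \<le> node_mean (\<lambda>i. 2 * Rbar * (L1bar * r) - ?u i \<bullet> ?G i0)"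
        by (rule node_mean_mono)
      also have "\<dots> = 2 * Rbar * (L1bar * r) - node_mean ?u \<bullet> ?G i0"
        by (simp only: node_mean_diff[where u = "\<lambda>_. 2 * Rbar * (L1bar * r)"] node_mean_inner node_mean_const)
      finally have split: "node_mean (\<lambda>i. - (?u i \<bullet> ?G i))
          \<le> 2 * Rbar * (L1bar * r) - node_mean ?u \<bullet> ?G i0" .
      have "- (node_mean ?u \<bullet> ?G i0) \<le> norm (node_mean ?u) * norm (?G i0)"
        using norm_cauchy_schwarz[of "- node_mean ?u" "?G i0"] by simp
      also have "\<dots> \<le> Dv * (L1bar * Rbar)"
      proof (rule mult_mono)
        have "norm (node_mean (\<lambda>i. node_mean (v (Suc k)) - vh (Suc k) i)) \<le> Dv"
          using Dv[OF k] by (intro norm_node_mean_le_const) (simp add: norm_minus_commute)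
        then show "norm (node_mean ?u) \<le> Dv" by (simp add: node_mean_diff)
        show "norm (?G i0) \<le> L1bar * Rbar"
          by (rule order_trans[OF G_norm]) (use L1bar_pos x0_bd in \<open>intro mult_left_mono, auto\<close>)
      qed (use Dv0 in auto)
      finally have "node_mean (\<lambda>i. - (?u i \<bullet> ?G i)) \<le> 2 * Rbar * (L1bar * r) + Dv * (L1bar * Rbar)"
        using split by linarith
      moreover have "node_mean (\<lambda>i. - (?u i \<bullet> ?G i)) = - node_mean (\<lambda>i. ?u i \<bullet> ?G i)"
        using node_mean_diff[of "\<lambda>_. 0" "\<lambda>i. ?u i \<bullet> ?G i"] by simp
      ultimately show ?thesis by (simp add: mult_ac)
    qed
    have "V (Suc k) \<le> node_mean (\<lambda>i. (E k i xstar - E k i (y (k + 1) i)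
        + (f (x (k + 1) i) - f xstar) / ?A) + (?e - ?u i \<bullet> ?G i) * (1 / ?A'))"
      unfolding V_def using node_step by (intro node_mean_mono) (simp add: mult.commute)
    also have "\<dots> = V k + (?e - node_mean (\<lambda>i. ?u i \<bullet> ?G i)) * (1 / ?A')"
      unfolding V_def node_mean_add[where w = "\<lambda>i. (?e - ?u i \<bullet> ?G i) * (1 / ?A')"]
        node_mean_mult_right node_mean_diff[where u = "\<lambda>_. ?e"] node_mean_const ..
    also have "(?e - node_mean (\<lambda>i. ?u i \<bullet> ?G i)) * (1 / ?A') \<le> (\<alpha> * \<epsilon> / 2) * (1 / ?A')"
      using cross budget Apos by (intro mult_right_mono) auto
    also have "(\<alpha> * \<epsilon> / 2) * (1 / ?A') = \<epsilon> / 2 * (1 / (1 - \<alpha>) ^ Suc k - 1 / (1 - \<alpha>) ^ k)"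
      using alpha by (simp add: field_simps)
    finally show ?thesis by simp
  qed
  have V_le: "V k \<le> V 0 + \<epsilon> / 2 * (1 / (1 - \<alpha>) ^ k - 1)" if "k \<le> N" for k
    using that
  proof (induction k)
    case (Suc k)
    then have "V (Suc k) \<le> V 0 + \<epsilon> / 2 * (1 / (1 - \<alpha>) ^ k - 1)
        + \<epsilon> / 2 * (1 / (1 - \<alpha>) ^ Suc k - 1 / (1 - \<alpha>) ^ k)"
      using V_step[OF Suc.prems] by simp
    then show ?case by (simp add: right_diff_distrib)
  qed simp

  \<comment> \<open>All nodes start from the same point, which mixing leaves unchanged, so every anchor is \<open>x0\<close>.\<close>
  have vh0: "vh 0 i = x0" for i
  proof -
    have "v 0 = (\<lambda>_. x0)" using v_init x_init by auto
    then show ?thesis using vh_step[of 0 i] consensus_const[OF mixing] by simp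
  qed
  define K where "K = \<mu>bar / 4 * R\<^sup>2 + \<mu>bar * inverse Rbar / 4 * R ^ 3"
  have V_0: "V 0 \<le> C * (f x0 - f xstar)"
    unfolding V_def
  proof (rule node_mean_le_const)
    fix i
    have E0: "E 0 i z = f (x 1 i) + \<mu>bar / 4 * (norm (z - x0))\<^sup>2
        + \<mu>bar * inverse Rbar / 4 * norm (z - x0) ^ 3" for z
      by (simp add: E_def kappa2_eq kappa3_eq vh0)
    have "f (x 1 i) \<le> E 0 i (y (0 + 1) i)"
      unfolding E0 using mubar Rbar_pos by (simp add: add_increasing2)
    moreover have "E 0 i xstar = f (x 1 i) + K"
      unfolding E0 by (simp add: K_def R_def norm_minus_commute)
    moreover have "f (x 1 i) \<le> f xstar + d1 * (Rbar + 2 * R) + 2 * d2 * R\<^sup>2 + 2 / 3 * L2bar * R ^ 3"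
    proof -
      have "f (x 1 i) \<le> f xstar + d1 * (norm (x 1 i - x0) + norm (xstar - x0))
          + 2 * d2 * (norm (xstar - x0))\<^sup>2 + 2 / 3 * L2bar * norm (xstar - x0) ^ 3"
        using inexact_cubic_step_value[OF x_min[of 0 i] gv_err[of 0 i] Hv_err[of 0 i], of xstar]
          d0 L2bar_pos by (simp add: vh0)
      moreover have "d1 * (norm (x 1 i - x0) + norm (xstar - x0)) \<le> d1 * (Rbar + 2 * R)"
        using norm_triangle_ineq4[of "x 1 i - xstar" "x0 - xstar"] xy_bounded[of 1 i] d0
        by (intro mult_left_mono) (auto simp: R_def norm_minus_commute)
      ultimately show ?thesis by (simp add: R_def norm_minus_commute)
    qed
    moreover have "K + (d1 * (Rbar + 2 * R) + 2 * d2 * R\<^sup>2 + 2 / 3 * L2bar * R ^ 3)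
        \<le> C * (f x0 - f xstar)"
    proof -
      \<comment> \<open>\<open>C\<close> dominates the bound on the initial potential divided by the lower bound \<open>\<mu>bar / 2 * R\<^sup>2\<close> on the
        initial suboptimality.\<close>
      have "C * (\<mu>bar / 2 * R\<^sup>2) = 2 * d1 * R + 2 * d1 * Rbar + 2 * d2 * R\<^sup>2 + K + 2 / 3 * L2bar * R ^ 3"
        using R_pos mubar Rbar_pos
        by (simp add: C_def D_eq K_def field_simps power2_eq_square power3_eq_cube)
      moreover have "C * (\<mu>bar / 2 * R\<^sup>2) \<le> C * (f x0 - f xstar)"
      proof (rule mult_left_mono)
        show "\<mu>bar / 2 * R\<^sup>2 \<le> f x0 - f xstar"
          using strongly_convex_minimizer_growth[OF sc xstar_min, of x0] by (simp add: R_def)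
        show "0 \<le> C" unfolding C_def using D_eq d0 R_pos mubar Rbar_pos L2bar_pos by simp
      qed
      moreover have "0 \<le> d1 * Rbar" using d0 Rbar_pos by simp
      moreover have "d1 * (Rbar + 2 * R) = d1 * Rbar + 2 * d1 * R" by (simp add: algebra_simps)
      ultimately show ?thesis by linarith
    qed
    ultimately show "E 0 i xstar - E 0 i (y (0 + 1) i)
        + (f (x (0 + 1) i) - f xstar) / (1 - \<alpha>) ^ 0 \<le> C * (f x0 - f xstar)"
      by simp
  qed

  let ?F = "node_mean (\<lambda>i. f (x (N + 1) i))"
  have ApN: "0 < (1 - \<alpha>) ^ N" using alpha by simp
  have "(?F - f xstar) / (1 - \<alpha>) ^ N \<le> V N"
  proof -
    have "node_mean (\<lambda>i. (f (x (N + 1) i) - f xstar) * (1 / (1 - \<alpha>) ^ N)) \<le> V N"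
      unfolding V_def using E_min[of N]
      by (intro node_mean_mono) (auto simp: is_arg_min_def not_less)
    then show ?thesis
      unfolding node_mean_mult_right node_mean_diff[where w = "\<lambda>_. f xstar"] node_mean_const
      by simp
  qed
  also have "\<dots> \<le> C * (f x0 - f xstar) + \<epsilon> / 2 * (1 / (1 - \<alpha>) ^ N - 1)"
    using V_le[of N] V_0 by simp
  also have "\<dots> \<le> C * (f x0 - f xstar) + \<epsilon> / 2 / (1 - \<alpha>) ^ N"
    using eps_pos by (simp add: right_diff_distrib)
  finally have "?F - f xstar \<le> (C * (f x0 - f xstar) + \<epsilon> / 2 / (1 - \<alpha>) ^ N) * (1 - \<alpha>) ^ N"
    using ApN by (simp add: pos_divide_le_eq)
  then have F_le: "?F - f xstar \<le> (1 - \<alpha>) ^ N * (C * (f x0 - f xstar)) + \<epsilon> / 2"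
    using ApN alpha by (simp add: distrib_left mult.commute split: if_splits)
  have "(1 - \<alpha>) ^ N * (C * (f x0 - f xstar)) \<le> \<epsilon> / 2"
  proof (rule geometric_decay_bound)
    have "0 \<le> 4 * d1 / (\<mu>bar * R)" "0 \<le> 4 * d1 * Rbar / (\<mu>bar * R\<^sup>2)" "0 \<le> 4 * d2 / \<mu>bar"
      "0 \<le> (8 * L2bar + 3 * \<mu>bar * inverse Rbar) / (6 * \<mu>bar) * R"
      using d0 R_pos mubar Rbar_pos L2bar_pos by simp_all
    then have "0 < C" unfolding C_def using D_eq[of 0] by simp
    moreover have "0 < f x0 - f xstar"
    proof -
      have "0 < \<mu>bar / 2 * R\<^sup>2" using mubar R_pos by simp
      with strongly_convex_minimizer_growth[OF sc xstar_min, of x0] show ?thesis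
        unfolding R_def by linarith
    qed
    ultimately show "0 < C * (f x0 - f xstar)" by simp
    have "x 0 = (\<lambda>_. x0)" using x_init by auto
    then show "int N \<ge> \<lceil>ln (2 * (C * (f x0 - f xstar)) / \<epsilon>) / ln (1 / (1 - \<alpha>))\<rceil>"
      using N_large by (simp add: mult.assoc)
  qed (use alpha eps_pos in auto)
  moreover have "f (node_mean (x (N + 1))) \<le> ?F"
    by (rule strongly_convex_jensen[OF sc]) (use mubar in simp)
  ultimately show ?thesis using F_le by linarith
qed

end
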